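(* Let $A,B$ be integers with $-B/2<A\leqslant B/2$, and let $\rho$ be the unique zero of $\phi_{A,B}(z):=\operatorname{Li}_2(z)+4\pi^2A+2\pi iB\log z$. Define $$c_0:=\begin{cases}\exp(2\pi iA/B)&\text{if }A\neq0,\\ \exp(\pi i/(12B))&\text{if }A=0,\end{cases}\qquad c_{n+1}:=c_n-\frac{\phi_{A,B}(c_n)}{\phi_{A,B}'(c_n)}\ (n\geqslant0).$$ Then $(c_n)$ converges to $\rho$ and $|\rho-c_n|<1.25\,(0.95)^{2^n}$ for all $n\geqslant0$.
   Context: $\log$ is the principal logarithm ($-\pi<\arg z\leqslant\pi$). $\operatorname{Li}_2$ is the principal dilogarithm: $\sum_{n\geqslant1}z^n/n^2$ for $|z|\leqslant1$, continued to $\mathbb{C}\setminus[1,\infty)$ by $-\int_0^z\log(1-u)\,du/u$, and on $[1,\infty)$ defined as the limit from below. $\phi_{A,B}'(z):=\bigl(-\log(1-z)+2\pi iB\bigr)/z$, the derivative of $\phi_{A,B}$ off $(-\infty,0]\cup[1,\infty)$. (For such $A,B$, $\phi_{A,B}$ has exactly one zero on $\mathbb{C}\setminus\{0\}$.) *)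

theory Defs
  imports "HOL-Complex_Analysis.Complex_Analysis"
begin

text \<open>
  The logarithm is the principal one, \<^const>\<open>Ln\<close>, with imaginary part in the interval
  from \<open>-\<pi>\<close> (excluded) to \<open>\<pi>\<close> (included).
\<close>

text \<open>
  The straight segment from \<open>0\<close> to \<open>z\<close> avoids the cut \<open>[1,\<infinity>)\<close> exactly when \<open>z\<close> does. The
  integrand has a removable singularity at \<open>0\<close>, where division by zero gives it
  the value \<open>0\<close>; this does not affect the integral.
\<close>

definition dilog_integral :: "complex \<Rightarrow> complex" where
  "dilog_integral z = - contour_integral (linepath 0 z) (\<lambda>u. Ln (1 - u) / u)"

text \<open>
  On the cut the value is the limit from below, that is, from the open lower half-plane. The point
  \<open>1\<close> is already covered by the series.
\<close>

definition dilog :: "complex \<Rightarrow> complex" where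
  "dilog z =
    (if norm z \<le> 1 then \<Sum>n. z ^ Suc n / of_nat (Suc n) ^ 2
     else if z \<notin> complex_of_real ` {1..} then dilog_integral z
     else Lim (at z within {w. Im w < 0}) dilog_integral)"

definition phi :: "int \<Rightarrow> int \<Rightarrow> complex \<Rightarrow> complex" where
  "phi A B z = dilog z + 4 * of_real pi ^ 2 * of_int A + 2 * of_real pi * \<i> * of_int B * Ln z"

definition phi_deriv :: "int \<Rightarrow> int \<Rightarrow> complex \<Rightarrow> complex" where
  "phi_deriv A B z = (- Ln (1 - z) + 2 * of_real pi * \<i> * of_int B) / z"

text \<open>
  The point \<open>0\<close> must be excluded explicitly: \<^term>\<open>Ln 0 = 0\<close> by convention, so that
  \<^term>\<open>phi 0 B\<close> would otherwise vanish there.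
\<close>

definition phi_zero :: "int \<Rightarrow> int \<Rightarrow> complex" where
  "phi_zero A B = (THE z. z \<noteq> 0 \<and> phi A B z = 0)"

primrec newton_seq :: "int \<Rightarrow> int \<Rightarrow> nat \<Rightarrow> complex" where
  "newton_seq A B 0 =
    (if A \<noteq> 0 then exp (2 * of_real pi * \<i> * of_int A / of_int B)
     else exp (of_real pi * \<i> / (12 * of_int B)))"
| "newton_seq A B (Suc n) =
    newton_seq A B n - phi A B (newton_seq A B n) / phi_deriv A B (newton_seq A B n)"

end

theory Submission
  imports Defs
begin

text \<open>
  Put \<open>w = log z\<close> and \<open>G w = \<phi>(exp w)\<close>, so \<open>G' w = 2\<pi>iB - log(1 - exp w)\<close> has positive imaginary part.
  Integrating along the ray from \<open>0\<close>, where \<open>G 0 = \<pi>\<^sup>2/6 + 4\<pi>\<^sup>2A\<close>, shows that a zero lies in the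
  half-strip \<open>0 < Im w \<le> \<pi>\<close> if \<open>A \<ge> 0\<close> and in \<open>-\<pi> < Im w < 0\<close> otherwise; integrating between two
  zeros in the same half-strip shows that they coincide.

  Existence and location come from Brouwer's theorem applied to
  \<open>w \<mapsto> 2\<pi>iA/B + i Li\<^sub>2(exp w)/(2\<pi>B)\<close>. Three cases differ in how close the zero is to a cut: if \<open>A \<noteq> 0\<close> and
  \<open>2\<bar>A\<bar> < B\<close> the disc of radius \<open>1/B\<close> about \<open>2\<pi>iA/B\<close> is invariant; if \<open>2A = B\<close> the zero lies at distance of
  order \<open>1/B\<close> above \<open>-1\<close>; if \<open>A = 0\<close> it lies at distance of order \<open>1/B\<close> from \<open>1\<close>.
  In each case the first Newton step, measured along the segment from \<open>c\<^sub>0\<close> to the zero, lands in a disc about the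
  zero on which the quadratic error estimate perpetuates itself.
\<close>

section \<open>The dilogarithm\<close>

text \<open>All constants must be uniform in \<open>B\<close>, and lengths near the zero scale like
  \<open>1/B\<close>. The numerator of \<open>phi_deriv\<close> varies at rate
  \<open>1/|1 - u|\<close>, that is at most \<open>B/h\<close> at distance \<open>h/B\<close> from
  \<open>1\<close>, while its own modulus is at least \<open>pi * B\<close>. The factor
  \<open>B\<close> cancels, so the quadratic error constant depends only on \<open>h\<close> and on
  bounds for \<open>|c|\<close> and \<open>|u|\<close>. What has to be proved in each case is
  therefore a lower bound of order \<open>1/B\<close> for the distance of the zero from the cuts,
  obtained from its imaginary part. Brouwer's theorem asks only for the size of the dilogarithm and
  for signs of its real and imaginary parts; a contraction estimate would have to control
  \<open>log(1 - exp w)\<close>, which is unbounded at the branch point \<open>w = 0\<close>. The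
  case \<open>A = 0\<close> is the delicate one: there the invariant set touches this branch point,
  and terms \<open>- x ln x\<close> have to be estimated to push the zero away from it.\<close>

definition dilog_series :: "complex \<Rightarrow> complex" where
  "dilog_series z = (\<Sum>n. z ^ Suc n / of_nat (Suc n) ^ 2)"

lemma inverse_squares_Suc_sums: "(\<lambda>n. 1 / real (Suc n) ^ 2) sums (pi\<^sup>2 / 6)"
  using inverse_squares_sums by (simp add: add.commute)

lemma dilog_series_term_bound:
  assumes "norm z \<le> 1"
  shows "norm (z ^ Suc n / of_nat (Suc n) ^ 2 :: complex) \<le> 1 / real (Suc n) ^ 2"
  using power_le_one[OF norm_ge_zero assms, of "Suc n"]
  by (simp add: norm_divide norm_power norm_mult divide_right_mono del: of_nat_Suc power_Suc)

lemma summable_dilog_series: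
  assumes "norm z \<le> 1"
  shows "summable (\<lambda>n. z ^ Suc n / of_nat (Suc n) ^ 2 :: complex)"
    and "summable (\<lambda>n. norm (z ^ Suc n / of_nat (Suc n) ^ 2 :: complex))"
proof -
  show "summable (\<lambda>n. norm (z ^ Suc n / of_nat (Suc n) ^ 2 :: complex))"
    by (rule summable_comparison_test'[OF sums_summable[OF inverse_squares_Suc_sums], of 0])
      (use dilog_series_term_bound[OF assms] in simp)
  then show "summable (\<lambda>n. z ^ Suc n / of_nat (Suc n) ^ 2 :: complex)"
    by (rule summable_norm_cancel)
qed

lemma norm_dilog_series_le:
  assumes "norm z \<le> 1"
  shows "norm (dilog_series z) \<le> pi\<^sup>2 / 6"
proof -
  have "norm (dilog_series z) \<le> (\<Sum>n. norm (z ^ Suc n / of_nat (Suc n) ^ 2 :: complex))"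
    unfolding dilog_series_def by (rule summable_norm[OF summable_dilog_series(2)[OF assms]])
  also have "\<dots> \<le> (\<Sum>n. 1 / real (Suc n) ^ 2)"
    by (intro suminf_le dilog_series_term_bound assms summable_dilog_series
        sums_summable[OF inverse_squares_Suc_sums])
  finally show ?thesis using sums_unique[OF inverse_squares_Suc_sums] by simp
qed

text \<open>With the first term split off, the remainder is below 0.645. This determines the sign of
  the real part near \<open>1\<close> and \<open>-1\<close>, about which the bound
  \<open>pi^2/6\<close> says nothing.\<close>

lemma norm_dilog_series_minus_le:
  assumes "norm z \<le> 1"
  shows "norm (dilog_series z - z) \<le> pi\<^sup>2 / 6 - 1"
proof -
  let ?f = "\<lambda>n. z ^ Suc n / of_nat (Suc n) ^ 2 :: complex"
  let ?g = "\<lambda>n. 1 / real (Suc n) ^ 2"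
  have "dilog_series z = (\<Sum>n. ?f (n + 1)) + ?f 0"
    unfolding dilog_series_def
    using suminf_split_initial_segment[OF summable_dilog_series(1)[OF assms], of 1] by simp
  then have "dilog_series z - z = (\<Sum>n. ?f (n + 1))"
    by simp
  moreover have "norm (\<Sum>n. ?f (n + 1)) \<le> (\<Sum>n. norm (?f (n + 1)))"
    by (rule summable_norm) (use summable_ignore_initial_segment[OF summable_dilog_series(2)[OF assms], of 1] in simp)
  moreover have "(\<Sum>n. norm (?f (n + 1))) \<le> (\<Sum>n. ?g (n + 1))"
    by (intro suminf_le dilog_series_term_bound assms
        summable_ignore_initial_segment[where f = "\<lambda>n. norm (?f n)"]
        summable_ignore_initial_segment[where f = ?g] summable_dilog_series
        sums_summable[OF inverse_squares_Suc_sums])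
  moreover have "(\<Sum>n. ?g (n + 1)) = pi\<^sup>2 / 6 - 1"
    using suminf_split_initial_segment[OF sums_summable[OF inverse_squares_Suc_sums], of 1]
      sums_unique[OF inverse_squares_Suc_sums] by (simp add: field_simps)
  ultimately show ?thesis by simp
qed

lemma continuous_on_dilog_series: "continuous_on (cball 0 1) dilog_series"
proof (rule uniform_limit_theorem)
  show "uniform_limit (cball 0 1) (\<lambda>N z. \<Sum>n<N. z ^ Suc n / of_nat (Suc n) ^ 2 :: complex)
      dilog_series sequentially"
    unfolding dilog_series_def
    by (rule Weierstrass_m_test[OF _ sums_summable[OF inverse_squares_Suc_sums]])
      (use dilog_series_term_bound in simp)
qed (auto intro!: always_eventually continuous_intros simp del: of_nat_Suc)

lemma dilog_series_1: "dilog_series 1 = of_real (pi\<^sup>2 / 6)"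
proof -
  have "(\<lambda>n. complex_of_real (1 / real (Suc n) ^ 2)) sums of_real (pi\<^sup>2 / 6)"
    by (rule sums_of_real[OF inverse_squares_Suc_sums])
  then show ?thesis unfolding dilog_series_def by (simp add: sums_iff)
qed

lemma Im_dilog_series_of_real:
  assumes "\<bar>t\<bar> \<le> 1"
  shows "Im (dilog_series (of_real t)) = 0"
proof -
  have "(\<lambda>n. Im (complex_of_real t ^ Suc n / of_nat (Suc n) ^ 2)) sums Im (dilog_series (of_real t))"
    unfolding dilog_series_def
    by (intro sums_Im summable_sums summable_dilog_series) (use assms in simp)
  moreover have "Im (complex_of_real t ^ Suc n / of_nat (Suc n) ^ 2) = 0" for n
  proof -
    have "complex_of_real t ^ Suc n / of_nat (Suc n) ^ 2 = of_real (t ^ Suc n / real (Suc n) ^ 2)"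
      by simp
    then show ?thesis by (metis Im_complex_of_real)
  qed
  ultimately show ?thesis by (simp add: sums_iff del: of_nat_Suc power_Suc)
qed

lemma has_field_derivative_dilog_series:
  assumes "norm z < 1" "z \<noteq> 0"
  shows "(dilog_series has_field_derivative (- Ln (1 - z) / z)) (at z)"
proof -
  define c :: "nat \<Rightarrow> complex" where "c n = 1 / of_nat n ^ 2" for n
  \<comment> \<open>Division by zero gives this value, so the series that starts at index 1 becomes
    a power series indexed from 0.\<close>
  have c0: "c 0 = 0" by (simp add: c_def)
  have summ: "summable (\<lambda>n. c n * w ^ n)" if "norm w \<le> 1" for w
  proof -
    have "summable (\<lambda>n. c (Suc n) * w ^ Suc n)"
      using summable_dilog_series(1)[OF that] by (simp add: c_def mult.commute)
    then show ?thesis by (subst (asm) summable_Suc_iff)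
  qed
  have eq: "dilog_series w = (\<Sum>n. c n * w ^ n)" if "norm w \<le> 1" for w
    using suminf_split_head[OF summ[OF that]] c0 by (simp add: dilog_series_def c_def mult.commute)
  have "((\<lambda>w. \<Sum>n. c n * w ^ n) has_field_derivative (\<Sum>n. diffs c n * z ^ n)) (at z)"
    by (rule termdiffs_strong'[where K = 1]) (use assms summ in auto)
  moreover have "(\<Sum>n. diffs c n * z ^ n) = - Ln (1 - z) / z"
  proof -
    have "(\<lambda>n. - (z ^ n) / of_nat n) sums Ln (1 - z)"
      using Ln_series'[of "-z"] assms by simp
    then have "(\<lambda>n. - (z ^ Suc n) / of_nat (Suc n)) sums Ln (1 - z)"
      by (subst sums_Suc_iff) simp
    then have "(\<lambda>n. - (1 / z) * (- (z ^ Suc n) / of_nat (Suc n))) sums (- (1 / z) * Ln (1 - z))"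
      by (rule sums_mult)
    moreover have "- (1 / z) * (- (z ^ Suc n) / of_nat (Suc n)) = diffs c n * z ^ n" for n
      using assms by (simp add: diffs_def c_def power2_eq_square del: of_nat_Suc)
    ultimately show ?thesis by (simp add: sums_iff)
  qed
  ultimately have "((\<lambda>w. \<Sum>n. c n * w ^ n) has_field_derivative (- Ln (1 - z) / z)) (at z)" by simp
  then show ?thesis
    by (rule has_field_derivative_transform_within_open[where S = "ball 0 1"])
      (use assms eq in auto)
qed

section \<open>Analytic continuation to the slit plane\<close>

definition slit_plane :: "complex set" where
  "slit_plane = - (of_real ` {1..})"

lemma slit_plane_iff: "z \<in> slit_plane \<longleftrightarrow> 1 - z \<notin> \<real>\<^sub>\<le>\<^sub>0"
proof -
  have "z \<in> of_real ` {1..} \<longleftrightarrow> 1 - z \<in> \<real>\<^sub>\<le>\<^sub>0"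
    by (force simp: complex_nonpos_Reals_iff image_iff complex_eq_iff)
  then show ?thesis by (simp add: slit_plane_def)
qed

lemma open_slit_plane: "open slit_plane"
proof -
  have "slit_plane = - ((\<lambda>z. 1 - z) -` \<real>\<^sub>\<le>\<^sub>0)"
    by (auto simp: slit_plane_iff)
  moreover have "closed ((\<lambda>z::complex. 1 - z) -` \<real>\<^sub>\<le>\<^sub>0)"
    by (intro closed_vimage) (auto intro!: continuous_intros)
  ultimately show ?thesis by (simp add: closed_def)
qed

lemma closed_segment_0_slit_plane:
  assumes "z \<in> slit_plane"
  shows "closed_segment 0 z \<subseteq> slit_plane"
proof
  fix u assume "u \<in> closed_segment 0 z"
  then obtain t where t: "0 \<le> t" "t \<le> 1" "u = of_real t * z"
    by (auto simp: closed_segment_def scaleR_conv_of_real)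
  show "u \<in> slit_plane"
  proof (rule ccontr)
    assume "u \<notin> slit_plane"
    then have *: "1 \<le> t * Re z" "t * Im z = 0"
      using t by (auto simp: slit_plane_iff complex_nonpos_Reals_iff)
    then have "t > 0" using t by (cases "t = 0") auto
    then have "Im z = 0" "Re z > 0" using * zero_less_mult_iff[of t "Re z"] by auto
    moreover have "t * Re z \<le> Re z" using t \<open>Re z > 0\<close> by simp
    ultimately show False
      using assms * by (auto simp: slit_plane_iff complex_nonpos_Reals_iff)
  qed
qed

lemma Ln_1_minus_has_field_derivative:
  assumes "z \<in> slit_plane"
  shows "((\<lambda>z. Ln (1 - z)) has_field_derivative (- 1 / (1 - z))) (at z)"
proof -
  have "1 - z \<notin> \<real>\<^sub>\<le>\<^sub>0" using assms by (simp add: slit_plane_iff)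
  then show ?thesis by (auto intro!: derivative_eq_intros simp: divide_inverse)
qed

text \<open>The integrand with its singularity at 0 removed, in the difference-quotient form of
  \<open>pole_lemma_open\<close> for the function \<open>Ln (1 - z)\<close> and the point 0.\<close>

definition dilog_kernel :: "complex \<Rightarrow> complex" where
  "dilog_kernel z =
    (if z = 0 then deriv (\<lambda>z. Ln (1 - z)) 0 else (Ln (1 - z) - Ln (1 - 0)) / (z - 0))"

lemma dilog_integral_has_field_derivative_kernel:
  assumes "z \<in> slit_plane"
  shows "(dilog_integral has_field_derivative (- dilog_kernel z)) (at z)"
proof -
  let ?L = "\<lambda>z::complex. Ln (1 - z)"
  have holL: "?L holomorphic_on slit_plane"
    using Ln_1_minus_has_field_derivative open_slit_plane
    by (auto simp: holomorphic_on_open)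
  have hol: "dilog_kernel holomorphic_on slit_plane"
    unfolding dilog_kernel_def by (rule pole_lemma_open[OF holL open_slit_plane])
  have 0: "0 \<in> slit_plane" by (simp add: slit_plane_iff)
  have star: "starlike slit_plane"
    unfolding starlike_def using 0 closed_segment_0_slit_plane by blast
  have "\<exists>g. \<forall>x \<in> slit_plane. (g has_field_derivative dilog_kernel x) (at x)"
    by (rule holomorphic_starlike_primitive[OF _ star open_slit_plane, of _ "{}"])
      (use hol open_slit_plane in \<open>auto intro: holomorphic_on_imp_continuous_on
         simp: holomorphic_on_imp_differentiable_at\<close>)
  then obtain g where g: "\<And>x. x \<in> slit_plane \<Longrightarrow> (g has_field_derivative dilog_kernel x) (at x)"
    by blast
  have int: "contour_integral (linepath 0 z) (\<lambda>u. Ln (1 - u) / u) = g z - g 0"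
    if z: "z \<in> slit_plane" for z
  proof (cases "z = 0")
    case False
    have "(dilog_kernel has_contour_integral (g z - g 0)) (linepath 0 z)"
      using contour_integral_primitive[of slit_plane g dilog_kernel "linepath 0 z"] g
        closed_segment_0_slit_plane[OF z] by (auto intro: has_field_derivative_at_within)
    \<comment> \<open>Along the segment the kernel and the integrand differ only at its initial
      point 0.\<close>
    then have "((\<lambda>u. Ln (1 - u) / u) has_contour_integral (g z - g 0)) (linepath 0 z)"
      unfolding has_contour_integral_linepath
      by (rule has_integral_spike_finite[of "{0}", rotated 2])
        (use False in \<open>auto simp: dilog_kernel_def linepath_def scaleR_conv_of_real\<close>)
    then show ?thesis by (rule contour_integral_unique)
  qed simp
  have "((\<lambda>z. - (g z - g 0)) has_field_derivative (- dilog_kernel z)) (at z)"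
    using g[OF assms] by (auto intro!: derivative_eq_intros)
  then show ?thesis
    by (rule has_field_derivative_transform_within_open[OF _ open_slit_plane assms])
      (simp add: dilog_integral_def int)
qed

lemma dilog_integral_has_field_derivative:
  assumes "z \<in> slit_plane" "z \<noteq> 0"
  shows "(dilog_integral has_field_derivative (- Ln (1 - z) / z)) (at z)"
  using dilog_integral_has_field_derivative_kernel[OF assms(1)] assms(2)
  by (simp add: dilog_kernel_def)

lemma continuous_on_dilog_integral: "continuous_on slit_plane dilog_integral"
  by (intro continuous_at_imp_continuous_on ballI
      DERIV_isCont[OF dilog_integral_has_field_derivative_kernel])

lemma ball_subset_slit_plane: "ball 0 1 \<subseteq> slit_plane"
proof
  fix z :: complex assume "z \<in> ball 0 1"
  then have "Re z < 1" using complex_Re_le_cmod[of z] by simp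
  then show "z \<in> slit_plane" by (simp add: slit_plane_iff complex_nonpos_Reals_iff)
qed

text \<open>The difference has derivative 0 on the punctured disc, continuity bridges the puncture,
  and both functions vanish at 0.\<close>

lemma dilog_integral_eq_series_ball:
  assumes "norm z < 1"
  shows "dilog_integral z = dilog_series z"
proof -
  have "((\<lambda>w. dilog_integral w - dilog_series w) has_field_derivative 0) (at w)"
    if "w \<in> ball 0 1 - {0}" for w
    using that ball_subset_slit_plane dilog_integral_has_field_derivative[of w]
      has_field_derivative_dilog_series[of w]
    by (auto intro!: derivative_eq_intros)
  moreover have "continuous_on (ball 0 1) (\<lambda>w. dilog_integral w - dilog_series w)"
    by (intro continuous_intros continuous_on_subset[OF continuous_on_dilog_integral]
        continuous_on_subset[OF continuous_on_dilog_series] ball_subset_slit_plane) auto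
  ultimately have "(\<lambda>w. dilog_integral w - dilog_series w) constant_on ball 0 1"
    by (intro DERIV_zero_connected_constant_on[of _ "{0}"] ballI)
      (simp_all del: Diff_iff)
  then have "dilog_integral z - dilog_series z = dilog_integral 0 - dilog_series 0"
    using assms unfolding constant_on_def by force
  moreover have "dilog_integral 0 = 0" by (simp add: dilog_integral_def)
  ultimately show ?thesis by (simp add: dilog_series_def)
qed

text \<open>Both functions are continuous up to the unit circle away from \<open>1\<close>, so the identity extends
  there radially.\<close>
lemma dilog_integral_eq_series:
  assumes "norm z \<le> 1" "z \<in> slit_plane"
  shows "dilog_integral z = dilog_series z"
proof -
  have seg: "closed_segment 0 z \<subseteq> slit_plane" by (rule closed_segment_0_slit_plane) fact
  have "of_real t * z \<in> slit_plane \<inter> cball 0 1" if "t \<in> {0..1}" for t :: real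
  proof -
    have "of_real t * z \<in> closed_segment 0 z"
      using that by (auto simp: closed_segment_def scaleR_conv_of_real)
    moreover have "norm (of_real t * z) \<le> 1"
      using that assms by (simp add: norm_mult mult_le_one)
    ultimately show ?thesis using seg by auto
  qed
  then have "continuous_on {0..1} (\<lambda>t::real. dilog_integral (of_real t * z) - dilog_series (of_real t * z))"
    by (intro continuous_on_compose2[OF continuous_on_dilog_integral]
        continuous_on_compose2[OF continuous_on_dilog_series] continuous_intros) auto
  then have *: "continuous_on (closure {0<..<1}) (\<lambda>t::real. dilog_integral (of_real t * z) - dilog_series (of_real t * z))"
    by simp
  have "(\<lambda>t::real. dilog_integral (of_real t * z) - dilog_series (of_real t * z)) 1 = 0"
  proof (rule continuous_constant_on_closure[OF *])
    fix t :: real assume "t \<in> {0<..<1}"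
    then have "t * norm z < 1" "t \<ge> 0"
      using order.strict_trans1[OF mult_left_le[of "norm z" t], of 1] assms(1) by auto
    then have "norm (of_real t * z) < 1" by (simp add: norm_mult)
    then show "dilog_integral (of_real t * z) - dilog_series (of_real t * z) = 0"
      by (simp add: dilog_integral_eq_series_ball)
  qed auto
  then show ?thesis by simp
qed

lemma dilog_eq_series: "norm z \<le> 1 \<Longrightarrow> dilog z = dilog_series z"
  by (simp add: dilog_def dilog_series_def)

lemma dilog_eq_integral: "z \<in> slit_plane \<Longrightarrow> dilog z = dilog_integral z"
  using dilog_integral_eq_series dilog_eq_series by (auto simp: dilog_def slit_plane_def)

lemma dilog_has_field_derivative:
  assumes "z \<in> slit_plane" "z \<noteq> 0"
  shows "(dilog has_field_derivative (- Ln (1 - z) / z)) (at z)"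
  by (rule has_field_derivative_transform_within_open[OF dilog_integral_has_field_derivative[OF assms]
        open_slit_plane assms(1)]) (simp add: dilog_eq_integral)

lemma has_field_derivative_dilog_exp:
  assumes "exp w \<in> slit_plane"
  shows "((\<lambda>w. dilog (exp w)) has_field_derivative (- Ln (1 - exp w))) (at w)"
  using DERIV_chain2[OF dilog_has_field_derivative[OF assms] DERIV_exp[of w]] by simp

section \<open>Inversion\<close>

text \<open>The right-hand side has its cut on the negative imaginary axis. It continues the
  logarithm from the closed upper half-plane analytically across the negative real axis.\<close>

lemma Ln_eq_rotated:
  assumes "v \<noteq> 0" "Im v \<ge> 0"
  shows "Ln v = Ln (- \<i> * v) + \<i> * of_real pi / 2"
  using Ln_times_ii[of "- \<i> * v"] assms by (simp add: algebra_simps)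

text \<open>\<open>1 - z\<close> is the product of \<open>- z\<close> and \<open>1 - 1 / z\<close>,
  whose imaginary parts have opposite signs; hence their arguments add up without leaving the
  principal range. For real \<open>z\<close> the first argument is 0.\<close>

lemma Ln_1_minus_split:
  assumes "- z \<notin> \<real>\<^sub>\<le>\<^sub>0"
  shows "Ln (1 - z) = Ln (- z) + Ln (1 - 1 / z)"
proof -
  have z: "z \<noteq> 0" "z \<noteq> 1" using assms by auto
  have prod: "1 - z = (- z) * (1 - 1 / z)" using z by (simp add: field_simps)
  have nz: "- z \<noteq> 0" "1 - 1 / z \<noteq> 0" using z by auto
  have Im: "Im (1 - 1 / z) = Im z / (norm z)\<^sup>2"
    by (simp add: Im_divide cmod_power2)
  have pos: "(norm z)\<^sup>2 > 0" using z by simp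
  have "- pi < Im (Ln (- z)) + Im (Ln (1 - 1 / z)) \<and> Im (Ln (- z)) + Im (Ln (1 - 1 / z)) \<le> pi"
  proof (cases "Im z" "0::real" rule: linorder_cases)
    case less
    have "0 < Im (Ln (- z)) \<and> Im (Ln (- z)) < pi"
      using Im_Ln_pos_lt[OF nz(1)] less by simp
    moreover have "Im (1 - 1 / z) < 0" unfolding Im using less pos by (rule divide_neg_pos)
    then have "- pi < Im (Ln (1 - 1 / z)) \<and> Im (Ln (1 - 1 / z)) < 0"
      using Im_Ln_pos_le[OF nz(2)] mpi_less_Im_Ln[OF nz(2)] Im_Ln_le_pi[OF nz(2)] by linarith
    ultimately show ?thesis by linarith
  next
    case equal
    then have "- z = of_real (- Re z)" by (simp add: complex_eq_iff)
    moreover have "Re z < 0" using assms equal by (auto simp: complex_nonpos_Reals_iff)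
    ultimately have "Im (Ln (- z)) = 0" by (metis Im_Ln_eq_0 Im_complex_of_real Re_complex_of_real
        neg_0_less_iff_less nz(1))
    then show ?thesis using mpi_less_Im_Ln[OF nz(2)] Im_Ln_le_pi[OF nz(2)] by simp
  next
    case greater
    have "Im (1 - 1 / z) > 0" unfolding Im using greater pos by (rule divide_pos_pos)
    then have "0 < Im (Ln (1 - 1 / z)) \<and> Im (Ln (1 - 1 / z)) < pi"
      using Im_Ln_pos_lt[OF nz(2)] by simp
    moreover have "- pi < Im (Ln (- z)) \<and> Im (Ln (- z)) < 0"
      using Im_Ln_pos_le[OF nz(1)] mpi_less_Im_Ln[OF nz(1)] Im_Ln_le_pi[OF nz(1)] greater by simp
    ultimately show ?thesis by linarith
  qed
  then show ?thesis unfolding prod by (intro Ln_times_simple nz) auto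
qed

text \<open>Both sides have the same derivative on the plane slit along \<open>[0,\<infinity>)\<close>; the constant is found by
  approaching \<open>1\<close> along the unit circle.\<close>
lemma dilog_inversion_off_cut:
  assumes "- z \<notin> \<real>\<^sub>\<le>\<^sub>0"
  shows "dilog z = - of_real (pi\<^sup>2 / 6) - (Ln (- z))\<^sup>2 / 2 - dilog (1 / z)"
proof -
  define S where "S = {z::complex. - z \<notin> \<real>\<^sub>\<le>\<^sub>0}"
  define D where "D z = dilog z + dilog (1 / z) + (Ln (- z))\<^sup>2 / 2" for z
  have S_eq: "S = (\<lambda>z. - 1 + z) ` slit_plane"
  proof -
    have "z \<in> S \<longleftrightarrow> z + 1 \<in> slit_plane" for z by (simp add: S_def slit_plane_iff)
    then show ?thesis by (force simp: image_iff)
  qed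
  have "starlike slit_plane"
    unfolding starlike_def using closed_segment_0_slit_plane
    by (intro bexI[of _ 0]) (auto simp: slit_plane_iff)
  then have conn: "connected S"
    unfolding S_eq by (intro connected_continuous_image starlike_imp_connected continuous_intros)
  have op: "open S" using open_translation[OF open_slit_plane, of "- 1"] S_eq by simp
  have slit: "z \<in> slit_plane" "1 / z \<in> slit_plane" "z \<noteq> 0" if "z \<in> S" for z
  proof -
    show "z \<noteq> 0" "z \<in> slit_plane"
      using that by (auto simp: S_def slit_plane_iff complex_nonpos_Reals_iff)
    show "1 / z \<in> slit_plane"
    proof (rule ccontr)
      assume "\<not> ?thesis"
      then have *: "1 \<le> Re z / (norm z)\<^sup>2" "Im z = 0"
        using \<open>z \<noteq> 0\<close> by (auto simp: slit_plane_iff complex_nonpos_Reals_iff Re_divide Im_divide cmod_power2)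
      then have "Re z > 0"
        using divide_nonpos_nonneg[of "Re z" "(norm z)\<^sup>2"] by force
      then show False using * that by (simp add: S_def complex_nonpos_Reals_iff)
    qed
  qed
  have deriv: "(D has_field_derivative 0) (at z)" if "z \<in> S" for z
  proof -
    note z = slit[OF that]
    have "((\<lambda>z. 1 / z) has_field_derivative (- 1 / z\<^sup>2)) (at z)"
      using z by (auto intro!: derivative_eq_intros simp: power2_eq_square)
    then have 1: "((\<lambda>z. dilog (1 / z)) has_field_derivative
        ((- Ln (1 - 1 / z) / (1 / z)) * (- 1 / z\<^sup>2))) (at z)"
      using z by (intro DERIV_chain2[OF dilog_has_field_derivative]) auto
    have "(D has_field_derivative (- Ln (1 - z) / z + (- Ln (1 - 1 / z) / (1 / z)) * (- 1 / z\<^sup>2)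
        + Ln (- z) * (1 / z))) (at z)"
      unfolding D_def using that z
      by (auto intro!: derivative_eq_intros 1 dilog_has_field_derivative simp: S_def field_simps)
    moreover have "- Ln (1 - z) / z + (- Ln (1 - 1 / z) / (1 / z)) * (- 1 / z\<^sup>2)
        + Ln (- z) * (1 / z) = 0"
      using Ln_1_minus_split[of z] that z by (simp add: S_def field_simps power2_eq_square)
    ultimately show ?thesis by simp
  qed
  have "D constant_on S"
  proof (rule DERIV_zero_connected_constant_on[OF conn op, of "{}"])
    show "continuous_on S D"
      by (intro continuous_at_imp_continuous_on ballI) (use deriv DERIV_isCont in blast)
  qed (use deriv in auto)
  then obtain c where c: "\<And>z. z \<in> S \<Longrightarrow> D z = c" by (auto simp: constant_on_def)
  \<comment> \<open>\<open>h\<close> is \<open>D\<close> along the upper unit circle, written so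
    that it stays continuous at angle 0, where \<open>D\<close> itself meets the cut of
    \<open>Ln (- z)\<close>. There the two series give \<open>pi^2/3\<close> and the square gives
    \<open>- pi^2/2\<close>.\<close>
  define h where "h \<theta> = dilog_series (cis \<theta>) + dilog_series (cis (- \<theta>))
    + (\<i> * (of_real \<theta> - of_real pi))\<^sup>2 / 2" for \<theta>
  have "continuous_on UNIV h"
    unfolding h_def
    by (intro continuous_intros continuous_on_compose2[OF continuous_on_dilog_series]) auto
  then have conth: "continuous_on (closure {0<..<pi}) h" by (rule continuous_on_subset) simp
  have "h 0 = c"
  proof (rule continuous_constant_on_closure[OF conth])
    fix \<theta> assume \<theta>: "\<theta> \<in> {0<..<pi}"
    have "- cis \<theta> = exp (\<i> * of_real (\<theta> - pi))"
      by (simp add: cis_conv_exp exp_diff exp_add right_diff_distrib)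
    then have "Ln (- cis \<theta>) = \<i> * (of_real \<theta> - of_real pi)"
      using \<theta> by (simp add: Ln_exp algebra_simps)
    moreover have "cis \<theta> \<in> S"
      using \<theta> sin_gt_zero[of \<theta>] by (auto simp: S_def complex_nonpos_Reals_iff)
    moreover have "1 / cis \<theta> = cis (- \<theta>)"
      by (metis cis_inverse inverse_eq_divide)
    ultimately show "h \<theta> = c" using c[of "cis \<theta>"]
      by (simp add: D_def h_def dilog_eq_series)
  qed auto
  then have "c = - of_real (pi\<^sup>2 / 6)"
    by (simp add: h_def dilog_series_1 power_mult_distrib field_simps)
  moreover have "D z = c" using assms by (intro c) (simp add: S_def)
  ultimately show ?thesis by (simp add: D_def algebra_simps)
qed

text \<open>The formula survives on the cut because the two conventions agree: when \<open>w\<close>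
  approaches the cut from below, \<open>- w\<close> approaches the negative axis from above, the
  side from which the principal logarithm is continuous.\<close>

lemma dilog_inversion:
  assumes "norm z > 1"
  shows "dilog z = - of_real (pi\<^sup>2 / 6) - (Ln (- z))\<^sup>2 / 2 - dilog_series (1 / z)"
proof -
  have le1: "norm (1 / w) \<le> 1" if "norm w > 1" for w :: complex
    using that by (simp add: norm_divide divide_simps)
  show ?thesis
  proof (cases "- z \<in> \<real>\<^sub>\<le>\<^sub>0")
    case False
    then show ?thesis using dilog_inversion_off_cut[of z] le1[OF assms] by (simp add: dilog_eq_series)
  next
    case True
    define R where "R w = - of_real (pi\<^sup>2 / 6) - (Ln (- w))\<^sup>2 / 2 - dilog_series (1 / w)" for w
    \<comment> \<open>The rotated logarithm makes this version of \<open>R\<close> continuous at the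
      point \<open>z\<close> of the cut, while it equals \<open>R\<close> on the closed lower
      half-plane away from 0.\<close>
    define T where "T w = - of_real (pi\<^sup>2 / 6) - (Ln (\<i> * w) + \<i> * of_real pi / 2)\<^sup>2 / 2
      - dilog_series (1 / w)" for w
    have T_eq: "T w = R w" if "w \<noteq> 0" "Im w \<le> 0" for w
      using Ln_eq_rotated[of "- w"] that by (simp add: T_def R_def)
    have z: "Re z > 0" "Im z = 0" "z \<noteq> 0"
      using True assms by (auto simp: complex_nonpos_Reals_iff complex_neq_0 cmod_def intro: ccontr)
    have "isCont T z"
    proof -
      have "isCont (\<lambda>w. dilog_series (1 / w)) z"
      proof (rule continuous_at_compose[of z "\<lambda>w. 1 / w" dilog_series, unfolded o_def])
        show "isCont (\<lambda>w. 1 / w) z" using z by (intro continuous_intros) auto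
        have "1 / z \<in> interior (cball 0 1)" using assms by (simp add: norm_divide divide_simps)
        then show "isCont dilog_series (1 / z)"
          using continuous_on_interior[OF continuous_on_dilog_series] by blast
      qed
      then show ?thesis unfolding T_def
        using z by (intro continuous_intros isCont_Ln') (auto simp: complex_nonpos_Reals_iff)
    qed
    then have lim: "(T \<longlongrightarrow> T z) (at z within {w. Im w < 0})"
      by (simp add: continuous_at_imp_continuous_at_within flip: continuous_within)
    have "eventually (\<lambda>w. w \<in> {w. norm w > 1}) (nhds z)"
      by (rule eventually_nhds_in_open) (use assms in \<open>auto intro!: open_Collect_less continuous_intros\<close>)
    then have "eventually (\<lambda>w. norm w > 1) (at z within {w. Im w < 0})"
      by (auto simp: eventually_at_filter elim: eventually_mono)
    moreover have "eventually (\<lambda>w. Im w < 0) (at z within {w. Im w < 0})"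
      by (auto simp: eventually_at_filter)
    ultimately have "eventually (\<lambda>w. T w = dilog_integral w) (at z within {w. Im w < 0})"
    proof eventually_elim
      case (elim w)
      then have "- w \<notin> \<real>\<^sub>\<le>\<^sub>0" "w \<in> slit_plane" "w \<noteq> 0"
        by (auto simp: complex_nonpos_Reals_iff slit_plane_iff)
      then show ?case using elim dilog_inversion_off_cut[of w] le1[of w] T_eq[of w]
        by (simp add: R_def dilog_eq_series flip: dilog_eq_integral)
    qed
    then have "(dilog_integral \<longlongrightarrow> T z) (at z within {w. Im w < 0})"
      using lim by (rule Lim_transform_eventually[rotated])
    moreover have "z islimpt {w. Im w < 0}"
      unfolding islimpt_approachable
    proof (intro allI impI)
      fix e :: real assume "e > 0"
      then show "\<exists>x\<in>{w. Im w < 0}. x \<noteq> z \<and> dist x z < e"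
        using z by (intro bexI[of _ "z - \<i> * of_real (e / 2)"])
          (auto simp: dist_norm norm_mult complex_eq_iff)
    qed
    then have "at z within {w. Im w < 0} \<noteq> bot" by (simp add: trivial_limit_within)
    ultimately have "Lim (at z within {w. Im w < 0}) dilog_integral = T z"
      by (metis tendsto_Lim)
    moreover have "z \<in> of_real ` {1..}"
    proof
      show "z = of_real (Re z)" using z by (simp add: complex_eq_iff)
      show "Re z \<in> {1..}" using z assms by (simp add: cmod_def)
    qed
    ultimately have "dilog z = T z" using assms by (simp add: dilog_def)
    then show ?thesis using T_eq[of z] z by (simp add: R_def)
  qed
qed

text \<open>The shift by \<open>pi\<close> brings the argument of \<open>- exp w\<close> back into
  the principal range. Real \<open>w\<close> belong to the second formula, in accordance with the
  limit from below.\<close>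

lemma dilog_exp_inversion:
  assumes "Re w > 0"
  shows "0 < Im w \<Longrightarrow> Im w \<le> pi \<Longrightarrow>
      dilog (exp w) = - of_real (pi\<^sup>2 / 6) - (w - \<i> * of_real pi)\<^sup>2 / 2 - dilog_series (exp (- w))"
    and "- pi < Im w \<Longrightarrow> Im w \<le> 0 \<Longrightarrow>
      dilog (exp w) = - of_real (pi\<^sup>2 / 6) - (w + \<i> * of_real pi)\<^sup>2 / 2 - dilog_series (exp (- w))"
proof -
  have *: "norm (exp w) > 1" using assms by simp
  have e: "exp (w - \<i> * of_real pi) = - exp w" "exp (w + \<i> * of_real pi) = - exp w"
    by (simp_all add: exp_diff exp_add)
  have inv: "1 / exp w = exp (- w)" by (simp add: exp_minus divide_inverse)
  show "dilog (exp w) = - of_real (pi\<^sup>2 / 6) - (w - \<i> * of_real pi)\<^sup>2 / 2 - dilog_series (exp (- w))"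
    if "0 < Im w" "Im w \<le> pi"
  proof -
    have "Ln (- exp w) = w - \<i> * of_real pi" unfolding e(1)[symmetric]
      by (rule Ln_exp) (use that pi_gt_zero in auto)
    then show ?thesis using dilog_inversion[OF *] inv by simp
  qed
  show "dilog (exp w) = - of_real (pi\<^sup>2 / 6) - (w + \<i> * of_real pi)\<^sup>2 / 2 - dilog_series (exp (- w))"
    if "- pi < Im w" "Im w \<le> 0"
  proof -
    have "Im (w + \<i> * of_real pi) = Im w + pi" by simp
    then have "Ln (- exp w) = w + \<i> * of_real pi" unfolding e(2)[symmetric]
      using that pi_gt_zero by (intro Ln_exp) linarith+
    then show ?thesis using dilog_inversion[OF *] inv by simp
  qed
qed

section \<open>Uniqueness of the zero\<close>

text \<open>A substitute for the mean value theorem: the quotient is the average of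
  \<open>g\<close>, and averaging preserves a positive imaginary part. The derivative is required
  only in the interior, so a path may start at a branch point.\<close>

lemma Im_difference_quotient_pos:
  fixes F :: "real \<Rightarrow> complex"
  assumes "continuous_on {0..1} F" "d \<noteq> 0"
    and deriv: "\<And>t. 0 < t \<Longrightarrow> t < 1 \<Longrightarrow> (F has_vector_derivative (d * g t)) (at t)"
    and pos: "\<And>t. 0 < t \<Longrightarrow> t < 1 \<Longrightarrow> Im (g t) > 0"
  shows "Im ((F 1 - F 0) / d) > 0"
proof -
  have "Im (F 0 / d) < Im (F 1 / d)"
  proof (rule DERIV_pos_imp_increasing_open[where a = 0 and b = 1 and f = "\<lambda>t. Im (F t / d)"])
    fix t :: real assume t: "0 < t" "t < 1"
    have "((\<lambda>t. F t / d) has_vector_derivative (d * g t / d)) (at t)"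
      using has_vector_derivative_mult_left[OF deriv[OF t], of "inverse d"]
      by (simp add: divide_inverse)
    then have "((\<lambda>t. F t / d) has_vector_derivative g t) (at t)" using assms(2) by simp
    then have "((\<lambda>t. Im (F t / d)) has_vector_derivative Im (g t)) (at t)"
      by (rule bounded_linear.has_vector_derivative[OF bounded_linear_Im])
    then show "\<exists>y. ((\<lambda>t. Im (F t / d)) has_real_derivative y) (at t) \<and> y > 0"
      using pos[OF t] by (auto simp: has_real_derivative_iff_has_vector_derivative)
  next
    show "continuous_on {0..1} (\<lambda>t. Im (F t / d))"
      using assms by (intro continuous_intros) auto
  qed simp
  then show ?thesis by (simp add: diff_divide_distrib)
qed

text \<open>The linear term \<open>w\<close> in place of \<open>Ln (exp w)\<close> removes the cut
  at \<open>Im w = pi\<close>; only the cut of the dilogarithm remains, at \<open>Im w\<close> a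
  multiple of \<open>2 * pi\<close>.\<close>

definition phi_log :: "int \<Rightarrow> int \<Rightarrow> complex \<Rightarrow> complex" where
  "phi_log A B w = dilog (exp w) + 4 * of_real pi ^ 2 * of_int A + 2 * of_real pi * \<i> * of_int B * w"

lemma phi_eq_phi_log: "z \<noteq> 0 \<Longrightarrow> phi A B z = phi_log A B (Ln z)"
  by (simp add: phi_def phi_log_def)

lemma phi_exp: "- pi < Im w \<Longrightarrow> Im w \<le> pi \<Longrightarrow> phi A B (exp w) = phi_log A B w"
  by (simp add: phi_eq_phi_log)

lemma phi_log_has_field_derivative:
  assumes "exp w \<in> slit_plane"
  shows "(phi_log A B has_field_derivative (2 * of_real pi * \<i> * of_int B - Ln (1 - exp w))) (at w)"
  unfolding phi_log_def
  by (auto intro!: derivative_eq_intros has_field_derivative_dilog_exp assms)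

lemma Im_phi_log_deriv_pos:
  assumes "B \<ge> 1" "exp w \<in> slit_plane"
  shows "Im (2 * of_real pi * \<i> * of_int B - Ln (1 - exp w)) > 0"
proof -
  have "1 - exp w \<noteq> 0" using assms(2) by (auto simp: slit_plane_iff)
  then have "Im (Ln (1 - exp w)) \<le> pi" by (rule Im_Ln_le_pi)
  moreover have "pi * 1 \<le> pi * real_of_int B" using assms(1) by (intro mult_left_mono) auto
  moreover have "Im (2 * of_real pi * \<i> * of_int B - Ln (1 - exp w))
      = 2 * (pi * real_of_int B) - Im (Ln (1 - exp w))" by simp
  ultimately show ?thesis using pi_gt_zero by linarith
qed

lemma exp_in_slit_plane:
  assumes "sin (Im w) \<noteq> 0 \<or> cos (Im w) < 0"
  shows "exp w \<in> slit_plane"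
proof (rule ccontr)
  assume "exp w \<notin> slit_plane"
  then have *: "1 \<le> exp (Re w) * cos (Im w)" "exp (Re w) * sin (Im w) = 0"
    by (auto simp: slit_plane_iff complex_nonpos_Reals_iff Re_exp Im_exp)
  then have "sin (Im w) = 0" by simp
  with assms have "cos (Im w) < 0" by simp
  then have "exp (Re w) * cos (Im w) < 0" by (intro mult_pos_neg) auto
  then show False using * by simp
qed

lemma exp_in_slit_plane_strip:
  assumes "0 < \<bar>Im w\<bar>" "\<bar>Im w\<bar> < 2 * pi"
  shows "exp w \<in> slit_plane"
proof (rule exp_in_slit_plane, rule disjCI)
  assume c: "\<not> cos (Im w) < 0"
  show "sin (Im w) \<noteq> 0"
  proof
    assume "sin (Im w) = 0"
    then have "\<bar>cos (Im w)\<bar> = 1" by (rule sin_zero_abs_cos_one)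
    then have "cos (Im w) = 1" using c by linarith
    then have "cos \<bar>Im w\<bar> = 1" by simp
    then obtain n :: int where n: "\<bar>Im w\<bar> = of_int n * (2 * pi)"
      by (auto simp: cos_one_2pi_int mult.assoc simp del: cos_abs_real)
    then have "0 < of_int n * (2 * pi)" "of_int n * (2 * pi) < 1 * (2 * pi)" using assms by auto
    then have "n > 0" "n < 1" using pi_gt_zero
      by (auto simp: zero_less_mult_iff simp del: pi_gt_zero)
    then show False by simp
  qed
qed

text \<open>The Noshiro-Warschawski argument: a holomorphic function on a convex set whose
  derivative stays in an open half-plane is injective.\<close>

lemma phi_log_inj_strip:
  assumes B: "B \<ge> 1"
    and strip: "(0 < Im v \<and> Im v < 2 * pi \<and> 0 < Im w \<and> Im w < 2 * pi) \<or>
      (- 2 * pi < Im v \<and> Im v < 0 \<and> - 2 * pi < Im w \<and> Im w < 0)"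
    and eq: "phi_log A B v = phi_log A B w"
  shows "v = w"
proof (rule ccontr)
  assume ne: "v \<noteq> w"
  define p where "p t = v + of_real t * (w - v)" for t :: real
  have slit: "exp (p t) \<in> slit_plane" if "0 \<le> t" "t \<le> 1" for t
  proof (rule exp_in_slit_plane_strip)
    have Imp: "Im (p t) = (1 - t) * Im v + t * Im w" by (simp add: p_def algebra_simps)
    have "(0 < Im (p t) \<and> Im (p t) < 2 * pi) \<or> (- 2 * pi < Im (p t) \<and> Im (p t) < 0)"
      using strip
    proof
      assume s: "0 < Im v \<and> Im v < 2 * pi \<and> 0 < Im w \<and> Im w < 2 * pi"
      have "0 < (1 - t) * Im v + t * Im w" "(1 - t) * Im v + t * Im w < 2 * pi"
        using s that convex_bound_lt[of "Im v" "2 * pi" "Im w" "1 - t" t]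
          convex_bound_lt[of "- Im v" "0" "- Im w" "1 - t" t] by auto
      then show ?thesis using Imp by simp
    next
      assume s: "- 2 * pi < Im v \<and> Im v < 0 \<and> - 2 * pi < Im w \<and> Im w < 0"
      have "(1 - t) * Im v + t * Im w < 0" "- (2 * pi) < (1 - t) * Im v + t * Im w"
        using s that convex_bound_lt[of "- Im v" "2 * pi" "- Im w" "1 - t" t]
          convex_bound_lt[of "Im v" "0" "Im w" "1 - t" t] by auto
      then show ?thesis using Imp by simp
    qed
    then show "0 < \<bar>Im (p t)\<bar>" "\<bar>Im (p t)\<bar> < 2 * pi" by auto
  qed
  have vd: "((\<lambda>t. phi_log A B (p t)) has_vector_derivative
      ((w - v) * (2 * of_real pi * \<i> * of_int B - Ln (1 - exp (p t))))) (at t)"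
    if "0 \<le> t" "t \<le> 1" for t
  proof -
    have "(p has_vector_derivative (w - v)) (at t)"
      unfolding p_def by (auto intro!: derivative_eq_intros)
    from field_vector_diff_chain_at[OF this phi_log_has_field_derivative[OF slit[OF that]]]
    show ?thesis by (simp add: o_def)
  qed
  have "Im ((phi_log A B (p 1) - phi_log A B (p 0)) / (w - v)) > 0"
  proof (rule Im_difference_quotient_pos[where
        g = "\<lambda>t. 2 * of_real pi * \<i> * of_int B - Ln (1 - exp (p t))"])
    show "continuous_on {0..1} (\<lambda>t. phi_log A B (p t))"
      by (intro continuous_at_imp_continuous_on ballI)
        (use vd has_vector_derivative_continuous in \<open>force\<close>)
  qed (use ne vd slit Im_phi_log_deriv_pos[OF B] in auto)
  then show False using eq by (simp add: p_def)
qed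

text \<open>The difficulty is \<open>t = 0\<close>, where the ray starts at the branch point.
  Depending on the sign of \<open>Re w\<close> its image lies inside or outside the unit disc, so
  the series or the inversion formula is continuous up to the start.\<close>

lemma continuous_on_dilog_exp_ray:
  assumes "- pi < Im w" "Im w \<le> pi" "Im w \<noteq> 0"
  shows "continuous_on {0..1} (\<lambda>t::real. dilog (exp (of_real t * w)))"
proof (cases "Re w \<le> 0")
  case True
  have "continuous_on {0..1} (\<lambda>t::real. dilog_series (exp (of_real t * w)))"
    using True by (intro continuous_on_compose2[OF continuous_on_dilog_series] continuous_intros)
      (auto simp: mult_nonneg_nonpos)
  then show ?thesis
    by (rule continuous_on_eq) (use True in \<open>auto simp: dilog_eq_series mult_nonneg_nonpos\<close>)
next
  case False
  \<comment> \<open>The sign selects the branch of the inversion formula on this side of the cut.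
    Either choice gives \<open>- pi^2/6 + pi^2/2 - pi^2/6 = pi^2/6\<close> at \<open>t = 0\<close>,
    the value of the dilogarithm at 1.\<close>
  define e :: complex where "e = of_real (sgn (Im w)) * \<i> * of_real pi"
  have "continuous_on {0..1} (\<lambda>t::real. - of_real (pi\<^sup>2 / 6) - (of_real t * w - e)\<^sup>2 / 2
      - dilog_series (exp (- (of_real t * w))))"
    using False by (intro continuous_on_compose2[OF continuous_on_dilog_series] continuous_intros) auto
  then show ?thesis
  proof (rule continuous_on_eq)
    fix t :: real assume t: "t \<in> {0..1}"
    show "- of_real (pi\<^sup>2 / 6) - (of_real t * w - e)\<^sup>2 / 2 - dilog_series (exp (- (of_real t * w)))
      = dilog (exp (of_real t * w))"
    proof (cases "t = 0")
      case True
      have "sgn (Im w) = 1 \<or> sgn (Im w) = - 1" using assms by (auto simp: sgn_if)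
      then have "e\<^sup>2 = - of_real (pi\<^sup>2)" by (auto simp: e_def power_mult_distrib)
      then show ?thesis using True by (simp add: dilog_eq_series dilog_series_1 field_simps)
    next
      case nz: False
      have le: "t * \<bar>Im w\<bar> \<le> pi" using t assms mult_le_one[of t "\<bar>Im w\<bar> / pi"]
        by (auto simp: field_simps abs_le_iff)
      have re: "Re (of_real t * w) > 0" using t nz False by auto
      show ?thesis
      proof (cases "Im w > 0")
        case True
        then have "0 < Im (of_real t * w)" "Im (of_real t * w) \<le> pi"
          using t nz le by auto
        from dilog_exp_inversion(1)[OF re this] show ?thesis using True by (simp add: e_def)
      next
        case False
        then have neg: "Im w < 0" using assms by simp
        then have "t * Im w \<le> 0" using t by (simp add: mult_nonneg_nonpos)
        have "(1 - t) * Im w \<le> 0" using t neg by (intro mult_nonneg_nonpos) auto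
        then have "- pi < t * Im w"
          using assms(1) unfolding left_diff_distrib by linarith
        then show ?thesis
          using dilog_exp_inversion(2)[OF re] neg \<open>t * Im w \<le> 0\<close> by (simp add: e_def)
      qed
    qed
  qed
qed

lemma phi_log_zero_Im_sign:
  assumes B: "B \<ge> 1" and w: "- pi < Im w" "Im w \<le> pi" and zero: "phi_log A B w = 0"
  shows "if A \<ge> 0 then Im w > 0 else Im w < 0"
proof -
  define C where "C = pi\<^sup>2 / 6 + 4 * pi\<^sup>2 * real_of_int A"
  have "C > 0" if "A \<ge> 0"
    using that by (simp add: C_def add_pos_nonneg)
  moreover have "C < 0" if "A < 0"
  proof -
    have "4 * pi\<^sup>2 * real_of_int A \<le> 4 * pi\<^sup>2 * (- 1)" using that by (intro mult_left_mono) auto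
    moreover have "pi\<^sup>2 > 0" by simp
    ultimately show ?thesis unfolding C_def by linarith
  qed
  ultimately have C: "if A \<ge> 0 then C > 0 else C < 0" by auto
  show ?thesis
  proof (cases "Im w = 0")
    case True
    \<comment> \<open>For \<open>Re w > 0\<close> the ray lies on the cut, so real zeros are
      excluded directly: the imaginary part is a nonzero multiple of \<open>Re w\<close>, and at
      \<open>w = 0\<close> the value is \<open>C\<close>.\<close>
    then have w_eq: "w = of_real (Re w)" by (simp add: complex_eq_iff)
    have Im_phi: "Im (phi_log A B w) = Im (dilog (exp w)) + 2 * pi * real_of_int B * Re w"
      using True by (simp add: phi_log_def flip: of_real_power)
    have e: "exp w = of_real (exp (Re w))" "exp (- w) = of_real (exp (- Re w))"
      by (metis w_eq exp_of_real, metis w_eq exp_of_real of_real_minus)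
    show ?thesis
    proof (cases "Re w" "0::real" rule: linorder_cases)
      case less
      then have "Im (dilog (exp w)) = 0"
        using Im_dilog_series_of_real[of "exp (Re w)"] by (simp add: e dilog_eq_series)
      then show ?thesis using Im_phi zero less B by simp
    next
      case equal
      then have "w = 0" using w_eq by simp
      then have "phi_log A B w = of_real C"
        by (simp add: phi_log_def dilog_eq_series dilog_series_1 C_def)
      then show ?thesis using C zero by (simp split: if_splits)
    next
      case greater
      \<comment> \<open>The value from below contributes \<open>- pi * Re w\<close>, so that the
        total imaginary part is \<open>(2 * B - 1) * pi * Re w\<close>.\<close>
      have "Im ((w + \<i> * of_real pi)\<^sup>2) = 2 * pi * Re w"
        using True by (simp add: power2_eq_square)
      then have "Im (dilog (exp w)) = - (pi * Re w)"
        using dilog_exp_inversion(2)[OF greater w(1)] True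
          Im_dilog_series_of_real[of "exp (- Re w)"] greater
        by (simp add: e(2) flip: of_real_power)
      then have "(2 * real_of_int B - 1) * (pi * Re w) = 0"
        using Im_phi zero by (simp add: algebra_simps)
      then show ?thesis using greater B by simp
    qed
  next
    case False
    have slit: "exp (of_real t * w) \<in> slit_plane" if "0 < t" "t < 1" for t :: real
    proof (rule exp_in_slit_plane_strip)
      have "t * \<bar>Im w\<bar> \<le> \<bar>Im w\<bar>" using that by (intro mult_left_le_one_le) auto
      moreover have "\<bar>Im w\<bar> \<le> pi" using w by auto
      moreover have "\<bar>Im (of_real t * w)\<bar> = t * \<bar>Im w\<bar>" using that by (simp add: abs_mult)
      ultimately show "\<bar>Im (of_real t * w)\<bar> < 2 * pi" using pi_gt_zero by linarith
      show "0 < \<bar>Im (of_real t * w)\<bar>" using that False by simp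
    qed
    have vd: "((\<lambda>t. phi_log A B (of_real t * w)) has_vector_derivative
        (w * (2 * of_real pi * \<i> * of_int B - Ln (1 - exp (of_real t * w))))) (at t)"
      if "0 < t" "t < 1" for t
    proof -
      have "((\<lambda>t. of_real t * w) has_vector_derivative w) (at t)"
        by (auto intro!: derivative_eq_intros)
      from field_vector_diff_chain_at[OF this phi_log_has_field_derivative[OF slit[OF that]]]
      show ?thesis by (simp add: o_def)
    qed
    have "Im ((phi_log A B (of_real 1 * w) - phi_log A B (of_real 0 * w)) / w) > 0"
    proof (rule Im_difference_quotient_pos[where
          g = "\<lambda>t. 2 * of_real pi * \<i> * of_int B - Ln (1 - exp (of_real t * w))"])
      show "continuous_on {0..1} (\<lambda>t. phi_log A B (of_real t * w))"
        unfolding phi_log_def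
        by (intro continuous_intros continuous_on_dilog_exp_ray w False)
    qed (use False vd slit Im_phi_log_deriv_pos[OF B] in auto)
    moreover have "phi_log A B 0 = of_real C"
      by (simp add: phi_log_def dilog_eq_series dilog_series_1 C_def)
    ultimately have "Im (- of_real C / w) > 0" using zero by simp
    then have "C * Im w / (norm w)\<^sup>2 > 0" by (simp add: Im_divide cmod_power2)
    then have "C * Im w > 0" by (metis zero_less_divide_iff not_less zero_le_power2)
    then show ?thesis using C by (auto simp: zero_less_mult_iff split: if_splits)
  qed
qed

lemma phi_zero_eqI:
  assumes B: "B \<ge> 1" and z: "z \<noteq> 0" "phi A B z = 0"
  shows "phi_zero A B = z"
  unfolding phi_zero_def
proof (rule the_equality)
  fix y assume y: "y \<noteq> 0 \<and> phi A B y = 0"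
  have zero: "phi_log A B (Ln z) = 0" "phi_log A B (Ln y) = 0"
    using z y by (auto simp: phi_eq_phi_log)
  have bd: "- pi < Im (Ln z)" "Im (Ln z) \<le> pi" "- pi < Im (Ln y)" "Im (Ln y) \<le> pi"
    using z y by (auto simp: mpi_less_Im_Ln Im_Ln_le_pi)
  have "(0 < Im (Ln y) \<and> 0 < Im (Ln z)) \<or> (Im (Ln y) < 0 \<and> Im (Ln z) < 0)"
    using phi_log_zero_Im_sign[OF B bd(1,2) zero(1)] phi_log_zero_Im_sign[OF B bd(3,4) zero(2)]
    by (cases "A \<ge> 0") simp_all
  then have "(0 < Im (Ln y) \<and> Im (Ln y) < 2 * pi \<and> 0 < Im (Ln z) \<and> Im (Ln z) < 2 * pi) \<or>
      (- 2 * pi < Im (Ln y) \<and> Im (Ln y) < 0 \<and> - 2 * pi < Im (Ln z) \<and> Im (Ln z) < 0)"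
    using bd pi_gt_zero by linarith
  then have "Ln y = Ln z" by (rule phi_log_inj_strip[OF B, where A = A]) (simp add: zero)
  then show "y = z" using z y by (metis exp_Ln)
qed (use z in simp)

section \<open>Newton steps\<close>

lemma phi_deriv_has_field_derivative:
  assumes "u \<in> slit_plane" "u \<notin> \<real>\<^sub>\<le>\<^sub>0"
  shows "(phi A B has_field_derivative phi_deriv A B u) (at u)"
proof -
  have "u \<noteq> 0" using assms by auto
  then show ?thesis
    using assms unfolding phi_def[abs_def] phi_deriv_def
    by (auto intro!: derivative_eq_intros dilog_has_field_derivative simp: field_simps)
qed

text \<open>The error \<open>r - (c - f c / f' c)\<close> is the value at \<open>r\<close> of a function of \<open>u\<close> that vanishes at \<open>c\<close> and
  whose derivative is \<open>O(u - c)\<close>.\<close>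
lemma newton_step:
  fixes f :: "complex \<Rightarrow> complex"
  assumes B: "B \<ge> 1" and m: "m > 0" and h: "h > 0"
    and deriv: "\<And>u. u \<in> closed_segment c r \<Longrightarrow> (f has_field_derivative phi_deriv A B u) (at u)"
    and zero: "f r = 0"
    and slit: "\<And>u. u \<in> closed_segment c r \<Longrightarrow> u \<in> slit_plane"
    and lower: "\<And>u. u \<in> closed_segment c r \<Longrightarrow> norm u \<ge> m"
      "\<And>u. u \<in> closed_segment c r \<Longrightarrow> norm (1 - u) \<ge> h / of_int B"
  shows "norm (r - (c - f c / phi_deriv A B c)) \<le> 1 / (2 * m) * (1 + norm c / (pi * h)) * (norm (r - c))\<^sup>2"
proof -
  define g where "g u = - Ln (1 - u) + 2 * of_real pi * \<i> * of_int B" for u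
  define d where "d = r - c"
  define p where "p t = c + of_real t * d" for t :: real
  define K where "K = 1 / m * (1 + norm c / (pi * h))"
  define \<Phi> where "\<Phi> t = of_real t * d - c / g c * (f (p t) - f c)" for t :: real
  have Bpos: "real_of_int B \<ge> 1" using B by simp
  have p_seg: "p t \<in> closed_segment c r" if "0 \<le> t" "t \<le> 1" for t
    using that unfolding closed_segment_def p_def d_def
    by (intro CollectI exI[of _ t]) (auto simp: scaleR_conv_of_real algebra_simps)
  have c_seg: "c \<in> closed_segment c r" by simp
  have c0: "c \<noteq> 0" using lower(1)[OF c_seg] m by auto
  have gc: "norm (g c) \<ge> pi * of_int B"
  proof -
    have "1 - c \<noteq> 0" using slit[OF c_seg] by (auto simp: slit_plane_iff)
    then have "Im (Ln (1 - c)) \<le> pi" by (rule Im_Ln_le_pi)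
    moreover have "Im (g c) = 2 * (pi * of_int B) - Im (Ln (1 - c))" by (simp add: g_def)
    moreover have "pi * 1 \<le> pi * real_of_int B" using Bpos by (intro mult_left_mono) auto
    ultimately have "pi * of_int B \<le> Im (g c)" by linarith
    then show ?thesis using abs_Im_le_cmod[of "g c"] by linarith
  qed
  have piB: "pi * of_int B > 0" using Bpos by simp
  then have gc0: "g c \<noteq> 0" using gc by auto
  have g_lip: "norm (g u - g c) \<le> of_int B / h * norm (u - c)" if "u \<in> closed_segment c r" for u
  proof (rule field_differentiable_bound[OF convex_closed_segment _ _ that c_seg])
    fix z assume z: "z \<in> closed_segment c r"
    have "(g has_field_derivative (- (- 1 / (1 - z)) + 0)) (at z)"
      unfolding g_def
      by (intro DERIV_add DERIV_minus DERIV_const Ln_1_minus_has_field_derivative slit z)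
    then show "(g has_field_derivative 1 / (1 - z)) (at z within closed_segment c r)"
      by (simp add: has_field_derivative_at_within)
    have "norm (1 - z) > 0" using lower(2)[OF z] divide_pos_pos[of h "of_int B"] h Bpos by linarith
    then show "norm (1 / (1 - z)) \<le> of_int B / h"
      using lower(2)[OF z] h Bpos by (simp add: norm_divide field_simps)
  qed
  have vd: "(\<Phi> has_vector_derivative (d - c / g c * (d * (g (p t) / p t)))) (at t)"
    if "0 \<le> t" "t \<le> 1" for t
  proof -
    have "(p has_vector_derivative d) (at t)"
      unfolding p_def by (auto intro!: derivative_eq_intros)
    from field_vector_diff_chain_at[OF this deriv[OF p_seg[OF that]]]
    have "((\<lambda>t. f (p t)) has_vector_derivative (d * (g (p t) / p t))) (at t)"
      by (simp add: o_def phi_deriv_def g_def)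
    then show ?thesis unfolding \<Phi>_def
      by (auto intro!: derivative_eq_intros)
  qed
  have bound: "norm (d - c / g c * (d * (g (p t) / p t))) \<le> K * (norm d)\<^sup>2 * t"
    if t: "0 \<le> t" "t \<le> 1" for t
  proof -
    let ?u = "p t"
    note u = p_seg[OF t]
    have u0: "?u \<noteq> 0" using lower(1)[OF u] m by auto
    have uc: "norm (?u - c) = t * norm d" using t by (simp add: p_def norm_mult)
    \<comment> \<open>This separates the change of the factor \<open>1 / u\<close> from the change
      of \<open>g\<close>; both vanish to first order at \<open>c\<close>.\<close>
    have "d - c / g c * (d * (g ?u / ?u)) = d * ((?u - c) / ?u - c * (g ?u - g c) / (?u * g c))"
      using u0 gc0 by (simp add: field_simps)
    also have "norm \<dots> \<le> norm d * (norm (?u - c) / norm ?u + norm c * norm (g ?u - g c) / (norm ?u * norm (g c)))"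
      using norm_triangle_ineq4[of "(?u - c) / ?u" "c * (g ?u - g c) / (?u * g c)"]
      by (simp add: norm_mult norm_divide mult_left_mono)
    also have "\<dots> \<le> norm d * (norm (?u - c) / m + norm c * (of_int B / h * norm (?u - c)) / (m * (pi * of_int B)))"
      using lower(1)[OF u] m gc piB g_lip[OF u] h Bpos
      by (intro mult_left_mono add_mono frac_le mult_mono mult_nonneg_nonneg divide_nonneg_nonneg) auto
    also have "\<dots> = K * (norm d)\<^sup>2 * t"
      using m h Bpos unfolding uc K_def by (simp add: field_simps power2_eq_square)
    finally show ?thesis .
  qed
  \<comment> \<open>Integrating a bound linear in \<open>t\<close>, instead of using its maximum,
    produces the factor 1/2 of the conclusion.\<close>
  have "norm (\<Phi> 1 - \<Phi> 0) \<le> K * (norm d)\<^sup>2 / 2 * 1\<^sup>2 - K * (norm d)\<^sup>2 / 2 * 0\<^sup>2"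
  proof (rule differentiable_bound_general[where f' = "\<lambda>t. d - c / g c * (d * (g (p t) / p t))"
        and \<phi> = "\<lambda>t. K * (norm d)\<^sup>2 / 2 * t\<^sup>2" and \<phi>' = "\<lambda>t. K * (norm d)\<^sup>2 * t"])
    show "continuous_on {0..1} \<Phi>"
      by (intro continuous_at_imp_continuous_on ballI)
        (use vd has_vector_derivative_continuous in force)
    show "((\<lambda>t. K * (norm d)\<^sup>2 / 2 * t\<^sup>2) has_vector_derivative K * (norm d)\<^sup>2 * t) (at t)" for t
      by (auto intro!: derivative_eq_intros simp flip: has_real_derivative_iff_has_vector_derivative)
  qed (use vd bound in \<open>auto intro!: continuous_intros\<close>)
  moreover have "phi_deriv A B c = g c / c" by (simp add: phi_deriv_def g_def)
  then have "\<Phi> 1 - \<Phi> 0 = r - (c - f c / phi_deriv A B c)"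
    using zero c0 gc0 by (simp add: \<Phi>_def p_def d_def)
  ultimately show ?thesis by (simp add: K_def d_def field_simps)
qed

text \<open>Multiplied by \<open>K\<close>, the error is at least squared at each step. The
  constants of the theorem enter here: \<open>0.8 = 1 / 1.25\<close> and
  \<open>0.9025 = 0.95^2\<close>. The initial error is outside the quadratic regime and is only
  compared with \<open>1.25 * 0.95 = 1.1875\<close>. The condition on \<open>Im u\<close> keeps the
  ball off the cuts of both the dilogarithm and the logarithm.\<close>

lemma newton_tail:
  assumes B: "B \<ge> 1" and r: "phi A B r = 0"
    and m: "m > 0" and h: "h > 0"
    and ball: "\<And>u. norm (u - r) \<le> \<epsilon> \<Longrightarrow> Im u \<noteq> 0"
      "\<And>u. norm (u - r) \<le> \<epsilon> \<Longrightarrow> norm u \<ge> m"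
      "\<And>u. norm (u - r) \<le> \<epsilon> \<Longrightarrow> norm (1 - u) \<ge> h / of_int B"
    and M: "norm r + \<epsilon> \<le> M"
    and K: "1 / (2 * m) * (1 + M / (pi * h)) \<le> K" "0.8 \<le> K" "K * \<epsilon> < 0.9025"
    and e0: "norm (r - newton_seq A B 0) < 1.18"
    and e1: "norm (r - newton_seq A B 1) \<le> \<epsilon>"
  shows "newton_seq A B \<longlonglongrightarrow> phi_zero A B \<and>
    (\<forall>n. norm (phi_zero A B - newton_seq A B n) < 1.25 * 0.95 ^ (2 ^ n))"
proof -
  let ?c = "newton_seq A B"
  have \<epsilon>: "\<epsilon> \<ge> 0" using e1 norm_ge_zero order_trans by blast
  have "r \<noteq> 0" using ball(1)[of r] \<epsilon> by auto
  then have pz: "phi_zero A B = r" by (intro phi_zero_eqI B r)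
  have step: "norm (r - ?c (Suc n)) \<le> K * (norm (r - ?c n))\<^sup>2" if n: "norm (r - ?c n) \<le> \<epsilon>" for n
  proof -
    have seg: "norm (u - r) \<le> \<epsilon>" if "u \<in> closed_segment (?c n) r" for u
      using segment_bound(2)[of u "?c n" r] segment_bound(2)[of u r "?c n"] that n
      by (metis closed_segment_commute norm_minus_commute order_trans segment_bound(1))
    have slit: "u \<in> slit_plane \<and> u \<notin> \<real>\<^sub>\<le>\<^sub>0" if "u \<in> closed_segment (?c n) r" for u
      using ball(1)[OF seg[OF that]] by (auto simp: slit_plane_iff complex_nonpos_Reals_iff)
    have "norm (r - (?c n - phi A B (?c n) / phi_deriv A B (?c n)))
        \<le> 1 / (2 * m) * (1 + norm (?c n) / (pi * h)) * (norm (r - ?c n))\<^sup>2"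
      using seg slit ball r
      by (intro newton_step[OF B m h] phi_deriv_has_field_derivative) auto
    also have "\<dots> \<le> K * (norm (r - ?c n))\<^sup>2"
    proof (rule mult_right_mono)
      have "norm (?c n) \<le> M"
        using M n norm_triangle_ineq2[of "?c n" r] by (simp add: norm_minus_commute)
      then have "1 / (2 * m) * (1 + norm (?c n) / (pi * h)) \<le> 1 / (2 * m) * (1 + M / (pi * h))"
        using m h by (intro mult_left_mono add_left_mono divide_right_mono) auto
      then show "1 / (2 * m) * (1 + norm (?c n) / (pi * h)) \<le> K" using K(1) by linarith
    qed simp
    finally show ?thesis by simp
  qed
  have Keps: "0 \<le> K * \<epsilon>" using K(2) \<epsilon> by simp
  \<comment> \<open>Only from the first iterate on is the error known to be at most \<epsilon>. The
    exponent thus lags by one doubling, which is why \<open>K * \<epsilon>\<close> is measured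
    against the square of 0.95.\<close>
  have "norm (r - ?c (Suc n)) \<le> \<epsilon> \<and> K * norm (r - ?c (Suc n)) \<le> (K * \<epsilon>) ^ (2 ^ n)" for n
  proof (induction n)
    case 0
    then show ?case using e1 K(2) by (auto intro!: mult_left_mono)
  next
    case (Suc n)
    let ?e = "norm (r - ?c (Suc n))"
    have s: "norm (r - ?c (Suc (Suc n))) \<le> K * ?e\<^sup>2" using step Suc by blast
    have "K * ?e \<le> K * \<epsilon>" using Suc K(2) by (intro mult_left_mono) auto
    then have "K * ?e * ?e \<le> 1 * ?e" using K(3) by (intro mult_right_mono) auto
    then have 1: "K * ?e\<^sup>2 \<le> \<epsilon>" using Suc by (simp add: power2_eq_square)
    have "K * norm (r - ?c (Suc (Suc n))) \<le> K * (K * ?e\<^sup>2)"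
      using s K(2) by (intro mult_left_mono) auto
    also have "\<dots> = (K * ?e)\<^sup>2" by (simp add: power2_eq_square)
    also have "\<dots> \<le> ((K * \<epsilon>) ^ (2 ^ n))\<^sup>2"
      using Suc K(2) by (intro power_mono) auto
    also have "\<dots> = (K * \<epsilon>) ^ (2 ^ Suc n)" by (simp add: power_mult[symmetric] mult.commute)
    finally show ?case using s 1 by auto
  qed
  then have Kbd: "K * norm (r - ?c (Suc n)) \<le> (K * \<epsilon>) ^ (2 ^ n)" for n by blast
  have bd: "norm (r - ?c n) < 1.25 * 0.95 ^ (2 ^ n)" for n
  proof (cases n)
    case 0
    then show ?thesis using e0 by simp
  next
    case (Suc k)
    have "0.8 * norm (r - ?c n) \<le> K * norm (r - ?c n)"
      using K(2) by (intro mult_right_mono) auto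
    also have "\<dots> \<le> (K * \<epsilon>) ^ (2 ^ k)" using Kbd Suc by simp
    also have "\<dots> < 0.9025 ^ (2 ^ k)" using K(3) Keps by (intro power_strict_mono) auto
    also have "(0.9025::real) = 0.95\<^sup>2" by (simp add: power2_eq_square)
    also have "(0.95\<^sup>2) ^ (2 ^ k) = (0.95::real) ^ (2 ^ n)"
      by (simp add: Suc power_mult[symmetric])
    finally show ?thesis by simp
  qed
  have lim: "(\<lambda>n. 1.25 * 0.95 ^ n :: real) \<longlonglongrightarrow> 0"
    by (intro tendsto_mult_right_zero LIMSEQ_realpow_zero) auto
  have "norm (?c n - r) \<le> 1.25 * 0.95 ^ n" for n
  proof -
    have "1.25 * (0.95::real) ^ (2 ^ n) \<le> 1.25 * 0.95 ^ n"
      by (intro mult_left_mono power_decreasing) auto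
    then show ?thesis using bd[of n] unfolding norm_minus_commute[of "?c n"] by linarith
  qed
  then have "(\<lambda>n. ?c n - r) \<longlonglongrightarrow> 0"
    by (intro Lim_null_comparison[OF _ lim] always_eventually allI)
  then have "?c \<longlonglongrightarrow> r" using LIM_zero_iff by blast
  then show ?thesis using bd pz by simp
qed

section \<open>Location of the zero\<close>

lemma sin_lower_bound:
  fixes x :: real
  assumes "x \<ge> 0"
  shows "x - x ^ 3 / 6 \<le> sin x"
proof -
  have "\<bar>sin x - (\<Sum>m<3. sin_coeff m * x ^ m)\<bar> \<le> inverse (fact 3) * \<bar>x\<bar> ^ 3"
    by (rule Maclaurin_sin_bound)
  then have "\<bar>sin x - x\<bar> \<le> x ^ 3 / 6"
    using assms by (simp add: sin_coeff_def eval_nat_numeral field_simps)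
  then show ?thesis by linarith
qed

text \<open>\<open>(7/5)^3 = 2.744\<close> exceeds e. The exponent 1/3 is the largest radius
  \<open>1/B\<close> in the interior case, where \<open>B >= 3\<close>.\<close>

lemma exp_third_less: "exp (1 / 3 :: real) < 7 / 5"
proof (rule ccontr)
  assume "\<not> ?thesis"
  then have "(7 / 5 :: real) ^ 3 \<le> exp (1 / 3) ^ 3" by (intro power_mono) auto
  moreover have "exp (1 / 3) ^ 3 = exp (1::real)" by (simp flip: exp_of_nat_mult)
  ultimately show False using e_less_272 by (simp add: power3_eq_cube)
qed

lemma norm_exp_minus_1_le:
  fixes v :: complex
  assumes "norm v \<le> R"
  shows "norm (exp v - 1) \<le> exp R * norm v"
proof -
  have "norm (exp v - exp 0) \<le> exp R * norm (v - 0)"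
  proof (rule field_differentiable_bound[of "cball 0 R" exp exp])
    fix z :: complex assume "z \<in> cball 0 R"
    then show "norm (exp z) \<le> exp R" using complex_Re_le_cmod[of z] by simp
  qed (use assms norm_ge_zero[of v] in \<open>auto intro: DERIV_exp has_field_derivative_at_within order_trans simp del: norm_ge_zero\<close>)
  then show ?thesis by simp
qed

text \<open>The equation \<open>phi_log A B w = 0\<close> solved for its linear term. Dropping the
  dilogarithm gives the logarithm of the initial value for \<open>A \<noteq> 0\<close>; for
  \<open>A = 0\<close> the value at \<open>w = 0\<close>, where the dilogarithm is
  \<open>pi^2/6\<close>, gives the other one.\<close>

definition log_map :: "int \<Rightarrow> int \<Rightarrow> complex \<Rightarrow> complex" where
  "log_map A B w = \<i> * of_real (2 * pi * of_int A / of_int B) + \<i> / of_real (2 * pi * of_int B) * dilog (exp w)"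

lemma phi_zero_of_log_map_fixed_point:
  assumes "B \<noteq> 0" "log_map A B w = w" "- pi < Im w" "Im w \<le> pi"
  shows "phi A B (exp w) = 0"
proof -
  have "2 * of_real pi * \<i> * of_int B * w = 2 * of_real pi * \<i> * of_int B * log_map A B w"
    using assms by simp
  also have "\<dots> = - 4 * of_real pi ^ 2 * of_int A - dilog (exp w)"
    using assms(1) unfolding log_map_def by (simp add: field_simps power2_eq_square)
  finally show ?thesis using assms by (simp add: phi_exp phi_log_def)
qed

lemma Re_log_map: "Re (log_map A B w) = - Im (dilog (exp w)) / (2 * pi * of_int B)"
  and Im_log_map: "Im (log_map A B w) = 2 * pi * of_int A / of_int B + Re (dilog (exp w)) / (2 * pi * of_int B)"
proof -
  have "\<i> / of_real (2 * pi * of_int B) = \<i> * of_real (1 / (2 * pi * of_int B))" by simp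
  then have "log_map A B w = \<i> * of_real (2 * pi * of_int A / of_int B)
      + \<i> * of_real (1 / (2 * pi * of_int B)) * dilog (exp w)"
    unfolding log_map_def by metis
  then show "Re (log_map A B w) = - Im (dilog (exp w)) / (2 * pi * of_int B)"
    "Im (log_map A B w) = 2 * pi * of_int A / of_int B + Re (dilog (exp w)) / (2 * pi * of_int B)"
    by (simp_all del: of_real_divide of_real_mult)
qed

lemma norm_log_map_diff:
  assumes "B > 0"
  shows "norm (log_map A B w - \<i> * of_real (2 * pi * of_int A / of_int B)) = norm (dilog (exp w)) / (2 * pi * of_int B)"
  using assms by (simp add: log_map_def norm_mult norm_divide)

section \<open>The interior case: \<open>A \<noteq> 0\<close> and
  \<open>2 * \<bar>A\<bar> < B\<close>\<close>

text \<open>The map \<open>log_map\<close> displaces \<open>2 pi i A/B\<close> by the modulus of the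
  dilogarithm divided by \<open>2 * pi * B\<close>, so \<open>2 * pi\<close> is exactly the bound
  that makes the disc of radius \<open>1/B\<close> invariant.\<close>

lemma norm_dilog_exp_le:
  assumes x: "\<bar>Re w\<bar> \<le> 1 / 3" and y: "- pi < Im w" "Im w \<le> pi"
  shows "norm (dilog (exp w)) \<le> 2 * pi"
proof (cases "Re w \<le> 0")
  case True
  then have "norm (dilog (exp w)) \<le> pi\<^sup>2 / 6"
    using norm_dilog_series_le[of "exp w"] by (simp add: dilog_eq_series)
  also have "\<dots> \<le> 2 * pi" using pi_less_4 by (simp add: power2_eq_square)
  finally show ?thesis .
next
  case False
  have "\<exists>L. Re L = Re w \<and> \<bar>Im L\<bar> \<le> pi \<and>
    dilog (exp w) = - of_real (pi\<^sup>2 / 6) - L\<^sup>2 / 2 - dilog_series (exp (- w))"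
  proof (cases "Im w > 0")
    case True
    then show ?thesis using dilog_exp_inversion(1)[of w] False y
      by (intro exI[of _ "w - \<i> * of_real pi"]) auto
  next
    case f: False
    then show ?thesis using dilog_exp_inversion(2)[of w] False y
      by (intro exI[of _ "w + \<i> * of_real pi"]) auto
  qed
  then obtain L where L: "Re L = Re w" "\<bar>Im L\<bar> \<le> pi"
    "dilog (exp w) = - of_real (pi\<^sup>2 / 6) - L\<^sup>2 / 2 - dilog_series (exp (- w))" by blast
  let ?Z = "- of_real (pi\<^sup>2 / 6) - L\<^sup>2 / 2 :: complex"
  have im: "\<bar>Im ?Z\<bar> \<le> 1 / 3 * pi"
  proof -
    have "Im ?Z = - (Re L * Im L)" by (simp add: power2_eq_square)
    then have "\<bar>Im ?Z\<bar> = \<bar>Re L\<bar> * \<bar>Im L\<bar>" by (simp add: abs_mult)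
    also have "\<dots> \<le> 1 / 3 * pi" using L x by (intro mult_mono) auto
    finally show ?thesis .
  qed
  \<comment> \<open>The upper bound is \<open>- pi^2/6 + pi^2/2\<close>; the lower one is
    \<open>- pi^2/6 - 1/18\<close>, for which \<open>pi >= 2\<close> suffices.\<close>
  have re: "\<bar>Re ?Z\<bar> \<le> pi\<^sup>2 / 3"
  proof -
    have Z: "Re ?Z = - pi\<^sup>2 / 6 - (Re L)\<^sup>2 / 2 + (Im L)\<^sup>2 / 2"
      by (simp add: power2_eq_square field_simps)
    have "(Im L)\<^sup>2 \<le> pi\<^sup>2" using L(2) by (metis abs_le_square_iff abs_of_nonneg pi_ge_zero)
    moreover have "(Re L)\<^sup>2 \<le> (1 / 3)\<^sup>2" using L(1) x by (metis abs_le_square_iff abs_of_nonneg zero_le_divide_1_iff zero_le_numeral)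
    moreover have "pi\<^sup>2 \<ge> 2\<^sup>2" using pi_ge_two by (intro power_mono) auto
    moreover have "(Re L)\<^sup>2 \<ge> 0" "(Im L)\<^sup>2 \<ge> 0" by auto
    moreover have "(1 / 3)\<^sup>2 = (1 / 9 :: real)" "2\<^sup>2 = (4::real)" by (simp_all add: power2_eq_square)
    ultimately show ?thesis unfolding Z abs_le_iff minus_divide_left[symmetric] by linarith
  qed
  have "norm (dilog_series (exp (- w))) \<le> pi\<^sup>2 / 6"
    using False by (intro norm_dilog_series_le) simp
  then have "norm (dilog (exp w)) \<le> pi\<^sup>2 / 3 + 1 / 3 * pi + pi\<^sup>2 / 6"
    unfolding L(3) using norm_triangle_ineq4[of ?Z "dilog_series (exp (- w))"] cmod_le[of ?Z] re im
    by linarith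
  also have "\<dots> = pi * (pi / 2 + 1 / 3)" by (simp add: power2_eq_square field_simps)
  also have "\<dots> \<le> pi * 2" using pi_approx by (intro mult_left_mono) auto
  finally show ?thesis by simp
qed

lemma newton_case_interior:
  assumes A: "A \<noteq> 0" and AB: "2 * \<bar>A\<bar> < B"
  shows "newton_seq A B \<longlonglongrightarrow> phi_zero A B \<and>
    (\<forall>n. norm (phi_zero A B - newton_seq A B n) < 1.25 * 0.95 ^ (2 ^ n))"
proof -
  define b where "b = 1 / real_of_int B"
  define \<theta> where "\<theta> = 2 * pi * of_int A / of_int B"
  define w0 where "w0 = \<i> * complex_of_real \<theta>"
  define K where "K = cball w0 b"
  define c where "c = exp w0"
  have B: "B \<ge> 3" using A AB by linarith
  have b: "b > 0" "b \<le> 1 / 3" "real_of_int B = 1 / b"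
    using B by (auto simp: b_def field_simps)
  \<comment> \<open>Integrality enters here: \<open>1 <= \<bar>A\<bar>\<close> and
    \<open>2 * \<bar>A\<bar> <= B - 1\<close> keep the angle at least \<open>pi * b\<close> away
    from 0 and from pi, more than the radius \<open>b\<close> of the disc.\<close>
  have \<theta>_abs: "2 * pi * b \<le> \<bar>\<theta>\<bar>" "\<bar>\<theta>\<bar> \<le> pi - pi * b"
  proof -
    have e: "\<bar>\<theta>\<bar> = 2 * pi * b * \<bar>of_int A\<bar>" using B by (simp add: \<theta>_def b_def abs_mult)
    have "2 * pi * b * 1 \<le> 2 * pi * b * \<bar>of_int A\<bar>"
      using A b(1) by (intro mult_left_mono) (auto simp flip: of_int_abs)
    then show "2 * pi * b \<le> \<bar>\<theta>\<bar>" by (simp add: e)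
    have "2 * \<bar>A\<bar> \<le> B - 1" using AB by simp
    then have "2 * \<bar>real_of_int A\<bar> \<le> 1 / b - 1" unfolding b(3)[symmetric] by linarith
    then have "pi * b * (2 * \<bar>real_of_int A\<bar>) \<le> pi * b * (1 / b - 1)"
      using b by (intro mult_left_mono) auto
    then show "\<bar>\<theta>\<bar> \<le> pi - pi * b" using b(1) by (simp add: e algebra_simps)
  qed
  have pb: "pi * b > 157 / 50 * b" using pi_approx b by (intro mult_strict_right_mono) auto
  have inK: "\<bar>Re w\<bar> \<le> b" "0 < \<bar>Im w\<bar>" "\<bar>Im w\<bar> < pi" "exp w \<in> slit_plane" if "w \<in> K" for w
  proof -
    have n: "norm (w - w0) \<le> b" using that by (simp add: K_def dist_norm norm_minus_commute)
    have "\<bar>Re (w - w0)\<bar> \<le> b" "\<bar>Im (w - w0)\<bar> \<le> b"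
      using n abs_Re_le_cmod[of "w - w0"] abs_Im_le_cmod[of "w - w0"] by linarith+
    then have i: "\<bar>Re w\<bar> \<le> b" "\<bar>Im w - \<theta>\<bar> \<le> b" by (simp_all add: w0_def)
    show "\<bar>Re w\<bar> \<le> b" by fact
    have "2 * pi * b = 2 * (pi * b)" by simp
    moreover have "\<bar>\<theta>\<bar> \<le> \<bar>Im w\<bar> + b" "\<bar>Im w\<bar> \<le> \<bar>\<theta>\<bar> + b" using i(2) by linarith+
    ultimately show "0 < \<bar>Im w\<bar>" "\<bar>Im w\<bar> < pi" using \<theta>_abs pb b(1) by linarith+
    then show "exp w \<in> slit_plane" using pi_gt_zero by (intro exp_in_slit_plane_strip) linarith+
  qed
  have "\<exists>w\<in>K. log_map A B w = w"
  proof (rule brouwer)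
    show "compact K" "convex K" "K \<noteq> {}" using b by (auto simp: K_def)
    show "continuous_on K (log_map A B)" unfolding log_map_def
      by (intro continuous_intros continuous_at_imp_continuous_on ballI
          DERIV_isCont[OF has_field_derivative_dilog_exp] inK)
    show "log_map A B \<in> K \<rightarrow> K"
    proof
      fix w assume w: "w \<in> K"
      have "norm (dilog (exp w)) \<le> 2 * pi"
        using inK[OF w] b by (intro norm_dilog_exp_le) linarith+
      then have "norm (dilog (exp w)) / (2 * pi * of_int B) \<le> 2 * pi / (2 * pi * of_int B)"
        using B by (intro divide_right_mono) auto
      then have "norm (log_map A B w - w0) \<le> b"
        using norm_log_map_diff[of B A w] B by (simp add: w0_def \<theta>_def b_def)
      then show "log_map A B w \<in> K" by (simp add: K_def dist_norm norm_minus_commute)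
    qed
  qed blast
  then obtain w where w: "w \<in> K" "log_map A B w = w" by blast
  define r where "r = exp w"
  have r_zero: "phi A B r = 0"
    unfolding r_def using inK[OF w(1)] w B by (intro phi_zero_of_log_map_fixed_point) auto
  have c_eq: "newton_seq A B 0 = c"
    using A by (simp add: c_def w0_def \<theta>_def mult_ac)
  have nc: "norm c = 1" by (simp add: c_def w0_def)
  have ww: "norm (w - w0) \<le> b" using w by (simp add: K_def dist_norm norm_minus_commute)
  have e14: "exp b \<le> 7 / 5" using exp_third_less b by (smt (verit) exp_le_cancel_iff)
  have e0: "norm (r - c) \<le> 7 / 5 * b"
  proof -
    have "r - c = c * (exp (w - w0) - 1)" by (simp add: r_def c_def exp_diff algebra_simps)
    then have "norm (r - c) = norm (exp (w - w0) - 1)" using nc by (simp add: norm_mult)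
    also have "\<dots> \<le> exp b * norm (w - w0)" by (rule norm_exp_minus_1_le[OF ww])
    also have "\<dots> \<le> 7 / 5 * b" using e14 ww by (intro mult_mono) auto
    finally show ?thesis .
  qed
  \<comment> \<open>Reflection at \<open>pi/2\<close> reduces to \<open>sin (pi * b)\<close>. Since
    \<open>pi * b <= 1.05\<close>, the cubic term costs at most 19 percent, and
    \<open>0.81 * 3.14 > 2.5\<close>. After subtracting \<open>7/5 * b\<close>, the distance
    \<open>11/10 * b\<close> remains on the segment from \<open>c\<close> to
    \<open>r\<close>.\<close>
  have Im_c: "\<bar>Im c\<bar> \<ge> 5 / 2 * b"
  proof -
    have "\<bar>Im c\<bar> = \<bar>sin \<bar>\<theta>\<bar>\<bar>" by (simp add: c_def w0_def Im_exp abs_if)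
    have pb2: "2 * pi * b = 2 * (pi * b)" by simp
    have "sin (pi * b) \<le> sin \<bar>\<theta>\<bar>"
    proof (cases "\<bar>\<theta>\<bar> \<le> pi / 2")
      case True
      then show ?thesis using \<theta>_abs pb b pb2 by (intro sin_monotone_2pi_le) linarith+
    next
      case False
      have "pi * b > 0" using b by simp
      then have "sin (pi * b) \<le> sin (pi - \<bar>\<theta>\<bar>)"
        using \<theta>_abs False by (intro sin_monotone_2pi_le) linarith+
      then show ?thesis by simp
    qed
    moreover have "pi * b - (pi * b) ^ 3 / 6 \<le> sin (pi * b)"
      using b by (intro sin_lower_bound) auto
    moreover have "(pi * b) ^ 3 / 6 \<le> 19 / 100 * (pi * b)"
    proof -
      have "(pi * b)\<^sup>2 \<le> 1.05\<^sup>2"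
      proof (rule power_mono)
        have "pi * b \<le> 3.15 * (1 / 3)" using pi_approx b by (intro mult_mono) auto
        then show "pi * b \<le> 1.05" by simp
      qed (use b in auto)
      then have "(pi * b) * (pi * b)\<^sup>2 \<le> (pi * b) * 1.05\<^sup>2" using b by (intro mult_left_mono) auto
      moreover have "(pi * b) ^ 3 = (pi * b) * (pi * b)\<^sup>2" by (simp add: power3_eq_cube power2_eq_square)
      moreover have "(1.05 :: real)\<^sup>2 = 441 / 400" by (simp add: power2_eq_square)
      ultimately have "(pi * b) ^ 3 \<le> pi * b * (441 / 400)" by metis
      moreover have "pi * b > 0" using b by simp
      ultimately show ?thesis by simp
    qed
    ultimately have "5 / 2 * b \<le> sin \<bar>\<theta>\<bar>" using pb b(1) by linarith
    then show ?thesis using \<open>\<bar>Im c\<bar> = \<bar>sin \<bar>\<theta>\<bar>\<bar>\<close> by linarith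
  qed
  have bB: "h / of_int B = h * b" for h :: real by (simp add: b_def)
  have near_c: "\<bar>Im u\<bar> \<ge> 11 / 10 * b" "norm u \<ge> 8 / 15" "norm (1 - u) \<ge> 11 / 10 / of_int B"
    if "norm (u - c) \<le> 7 / 5 * b" for u
  proof -
    have "\<bar>Im c - Im u\<bar> \<le> 7 / 5 * b" using abs_Im_le_cmod[of "u - c"] that by (simp add: abs_minus_commute)
    then show i: "\<bar>Im u\<bar> \<ge> 11 / 10 * b" using Im_c b by linarith
    show "norm (1 - u) \<ge> 11 / 10 / of_int B"
      unfolding bB using abs_Im_le_cmod[of "1 - u"] i by simp
    show "norm u \<ge> 8 / 15" using norm_triangle_ineq3[of u c] nc that b by linarith
  qed
  have seg: "norm (u - c) \<le> 7 / 5 * b" if "u \<in> closed_segment c r" for u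
    using segment_bound(1)[OF that] e0 by (simp add: norm_minus_commute)
  have slit: "u \<in> slit_plane" "u \<notin> \<real>\<^sub>\<le>\<^sub>0" if "u \<in> closed_segment c r" for u
    using near_c(1)[OF seg[OF that]] b by (auto simp: slit_plane_iff complex_nonpos_Reals_iff)
  have "norm (r - (c - phi A B c / phi_deriv A B c))
      \<le> 1 / (2 * (8 / 15)) * (1 + norm c / (pi * (11 / 10))) * (norm (r - c))\<^sup>2"
    by (rule newton_step)
      (use B near_c[OF seg] slit r_zero in \<open>auto intro: phi_deriv_has_field_derivative\<close>)
  also have "\<dots> \<le> 1.22 * (7 / 5 * b)\<^sup>2"
  proof (rule mult_mono)
    have "1 / (pi * (11 / 10)) \<le> 0.3" using pi_approx by (simp add: field_simps)
    then show "1 / (2 * (8 / 15)) * (1 + norm c / (pi * (11 / 10))) \<le> 1.22" using nc by simp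
    show "(norm (r - c))\<^sup>2 \<le> (7 / 5 * b)\<^sup>2" using e0 by (intro power_mono) auto
  qed auto
  also have "\<dots> \<le> 4 / 5 * b"
    using b by (simp add: power2_eq_square)
  finally have e1: "norm (r - newton_seq A B 1) \<le> 4 / 5 * b"
    by (simp only: One_nat_def newton_seq.simps(2) c_eq)
  have r_norm: "norm r \<le> 7 / 5" "norm r \<ge> 5 / 7"
  proof -
    have "Re w \<le> 1 / 3" "- (1 / 3) \<le> Re w" using inK(1)[OF w(1)] b by linarith+
    then have "exp (Re w) \<le> exp (1 / 3)" "exp (- (1 / 3)) \<le> exp (Re w)" by auto
    moreover have "exp (- (1 / 3)) \<ge> (5 / 7 :: real)"
      using exp_third_less unfolding exp_minus by (simp add: field_simps)
    ultimately show "norm r \<le> 7 / 5" "norm r \<ge> 5 / 7"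
      using exp_third_less unfolding r_def norm_exp_eq_Re by linarith+
  qed
  \<comment> \<open>With \<open>b <= 1/3\<close>, the constants are \<open>h = 11/10 - 4/5\<close>,
    \<open>m <= 5/7 - 4/15\<close> and \<open>M >= 7/5 + 4/15\<close>. Here
    \<open>K * \<epsilon>\<close> can reach \<open>63/20 * 4/15 = 0.84\<close>, the tightest of the
    three cases.\<close>
  show ?thesis
  proof (rule newton_tail[where r = r and m = "447 / 1000" and h = "3 / 10" and \<epsilon> = "4 / 5 * b" and M = "167 / 100" and K = "63 / 20"])
    show "norm (r - newton_seq A B 0) < 1.18" unfolding c_eq using e0 b by simp
    show "1 / (2 * (447 / 1000)) * (1 + 167 / 100 / (pi * (3 / 10))) \<le> 63 / 20"
      using pi_approx by (simp add: field_simps)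
    fix u assume u: "norm (u - r) \<le> 4 / 5 * b"
    have "\<bar>Im r\<bar> \<ge> 11 / 10 * b" using near_c(1)[OF e0] .
    then have i: "\<bar>Im u\<bar> \<ge> 3 / 10 * b"
      using abs_Im_le_cmod[of "u - r"] u by simp
    then show "Im u \<noteq> 0" using b by auto
    show "norm (1 - u) \<ge> 3 / 10 / of_int B"
      unfolding bB using abs_Im_le_cmod[of "1 - u"] i by simp
    show "norm u \<ge> 447 / 1000" using norm_triangle_ineq3[of u r] r_norm u b by linarith
  qed (use B r_zero r_norm b e1 in auto)
qed

section \<open>The case \<open>2 * A = B\<close>, with tools shared by the case
  \<open>A = 0\<close>\<close>

text \<open>Along the ray from 0 the imaginary part has derivative
  \<open>- Im (Ln (1 - t z)) / t\<close>, which is nonnegative because \<open>1 - t z\<close> lies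
  in the closed lower half-plane and has positive real part.\<close>

lemma Im_dilog_series_nonneg:
  assumes z: "norm z \<le> 1" "Im z \<ge> 0"
  shows "Im (dilog_series z) \<ge> 0"
proof (cases "z = 0")
  case True
  then show ?thesis using Im_dilog_series_of_real[of 0] by simp
next
  case False
  have in_ball: "norm (of_real t * z) \<le> 1" if "0 \<le> t" "t \<le> 1" for t :: real
    using that z by (simp add: norm_mult mult_le_one)
  have "Im (dilog_series (of_real 0 * z)) \<le> Im (dilog_series (of_real 1 * z))"
  proof (rule DERIV_nonneg_imp_increasing_open[where a = 0 and b = 1
        and f = "\<lambda>t. Im (dilog_series (of_real t * z))"])
    show "continuous_on {0..1} (\<lambda>t. Im (dilog_series (of_real t * z)))"
      by (intro continuous_intros continuous_on_compose2[OF continuous_on_dilog_series])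
        (use in_ball in auto)
  next
    fix t :: real assume t: "0 < t" "t < 1"
    let ?u = "of_real t * z"
    have "t * norm z < 1" using t z by (metis mult_left_le order.strict_trans1 less_imp_le)
    then have nu: "norm ?u < 1" using t by (simp add: norm_mult)
    have "?u \<noteq> 0" using t False by simp
    have "((\<lambda>t. of_real t * z) has_vector_derivative z) (at t)"
      by (auto intro!: derivative_eq_intros)
    from field_vector_diff_chain_at[OF this has_field_derivative_dilog_series[OF nu \<open>?u \<noteq> 0\<close>]]
    have "((\<lambda>t. dilog_series (of_real t * z)) has_vector_derivative (z * (- Ln (1 - ?u) / ?u))) (at t)"
      by (simp add: o_def)
    then have "((\<lambda>t. dilog_series (of_real t * z)) has_vector_derivative (- Ln (1 - ?u) / of_real t)) (at t)"
      using t False by simp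
    then have "((\<lambda>t. Im (dilog_series (of_real t * z))) has_vector_derivative Im (- Ln (1 - ?u) / of_real t)) (at t)"
      by (rule bounded_linear.has_vector_derivative[OF bounded_linear_Im])
    moreover have "Im (Ln (1 - ?u)) \<le> 0"
    proof -
      have re: "Re (1 - ?u) > 0" using complex_Re_le_cmod[of ?u] nu by simp
      then have nz: "1 - ?u \<noteq> 0" by (metis order_less_irrefl zero_complex.sel(1))
      have im: "Im (1 - ?u) \<le> 0" using t z by simp
      have "\<not> (0 < Im (Ln (1 - ?u)) \<and> Im (Ln (1 - ?u)) < pi)" using Im_Ln_pos_lt[OF nz] im by simp
      moreover have "Im (Ln (1 - ?u)) \<noteq> pi" using Im_Ln_eq_pi[OF nz] re by simp
      ultimately show ?thesis using Im_Ln_le_pi[OF nz] by linarith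
    qed
    then have "Im (- Ln (1 - ?u) / of_real t) \<ge> 0" using t by (simp add: Im_divide_of_real divide_nonpos_pos)
    ultimately show "\<exists>y. ((\<lambda>t. Im (dilog_series (of_real t * z))) has_real_derivative y) (at t) \<and> y \<ge> 0"
      by (auto simp: has_real_derivative_iff_has_vector_derivative)
  qed simp
  then show ?thesis using Im_dilog_series_of_real[of 0] by simp
qed

lemma norm_exp_minus_1_le_norm:
  fixes v :: complex
  assumes "Re v \<le> 0"
  shows "norm (exp v - 1) \<le> norm v"
proof -
  have "norm (exp v - exp 0) \<le> 1 * norm (v - 0)"
    by (rule field_differentiable_bound[OF convex_halfspace_Re_le[of 0], of exp exp])
      (use assms in \<open>auto intro: DERIV_exp has_field_derivative_at_within\<close>)
  then show ?thesis by simp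
qed

text \<open>Agrees with \<^const>\<open>phi\<close> on the closed upper half-plane but is analytic across the negative axis, on
  which the initial value \<open>-1\<close> of the case \<open>2A = B\<close> lies.\<close>
definition phi_rotated :: "int \<Rightarrow> int \<Rightarrow> complex \<Rightarrow> complex" where
  "phi_rotated A B z = dilog z + 4 * of_real pi ^ 2 * of_int A
    + 2 * of_real pi * \<i> * of_int B * (Ln (- \<i> * z) + \<i> * of_real pi / 2)"

lemma phi_rotated_eq_phi: "z \<noteq> 0 \<Longrightarrow> Im z \<ge> 0 \<Longrightarrow> phi_rotated A B z = phi A B z"
  using Ln_eq_rotated[of z] by (simp add: phi_rotated_def phi_def)

lemma phi_rotated_has_field_derivative:
  assumes "u \<in> slit_plane" "Re u \<noteq> 0"
  shows "(phi_rotated A B has_field_derivative phi_deriv A B u) (at u)"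
proof -
  have "u \<noteq> 0" "- \<i> * u \<notin> \<real>\<^sub>\<le>\<^sub>0" using assms by (auto simp: complex_nonpos_Reals_iff)
  then show ?thesis
    using assms unfolding phi_rotated_def[abs_def] phi_deriv_def
    by (auto intro!: derivative_eq_intros dilog_has_field_derivative simp: field_simps)
qed

lemma pi_sq_bound: "pi\<^sup>2 / 6 - 1 \<le> 129 / 200"
proof -
  have "pi\<^sup>2 \<le> 3.1416\<^sup>2" using pi_approx by (intro power_mono) auto
  then show ?thesis by (simp add: power2_eq_square)
qed

text \<open>On the left half-plane \<open>exp w\<close> stays in the unit disc, where the
  dilogarithm is at most \<open>pi^2/6\<close>. This gives a radius much smaller than
  \<open>1/B\<close>.\<close>

lemma norm_log_map_diff_le:
  assumes "B > 0" "Re w \<le> 0"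
  shows "norm (log_map A B w - \<i> * of_real (2 * pi * of_int A / of_int B)) \<le> pi / 12 / of_int B"
proof -
  have "norm (dilog (exp w)) \<le> pi\<^sup>2 / 6"
    using norm_dilog_series_le[of "exp w"] assms(2) by (simp add: dilog_eq_series)
  then have "norm (dilog (exp w)) / (2 * pi * of_int B) \<le> pi\<^sup>2 / 6 / (2 * pi * of_int B)"
    using assms(1) by (intro divide_right_mono) auto
  then show ?thesis using norm_log_map_diff[OF assms(1), of A w]
    by (simp add: power2_eq_square)
qed

lemma newton_case_half:
  assumes AB: "2 * A = B" and B: "B \<ge> 2"
  shows "newton_seq A B \<longlonglongrightarrow> phi_zero A B \<and>
    (\<forall>n. norm (phi_zero A B - newton_seq A B n) < 1.25 * 0.95 ^ (2 ^ n))"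
proof -
  define b where "b = 1 / real_of_int B"
  define w0 where "w0 = \<i> * complex_of_real pi"
  \<comment> \<open>Both half-planes are preserved: the dilogarithm has nonnegative imaginary part
    on the upper half disc, which gives \<open>Re w <= 0\<close>, and negative real part near -1,
    which gives \<open>Im w <= pi\<close>.\<close>
  define K where "K = cball w0 (pi / 12 * b) \<inter> {w. Re w \<le> 0} \<inter> {w. Im w \<le> pi}"
  have b: "b > 0" "b \<le> 1 / 2" "real_of_int B = 1 / b"
    using B by (auto simp: b_def field_simps)
  have A: "A \<noteq> 0" using AB B by auto
  have "real_of_int B = 2 * real_of_int A" using AB by linarith
  then have w0_eq: "w0 = \<i> * of_real (2 * pi * of_int A / of_int B)"
    using A by (simp add: w0_def)
  have radius: "pi / 12 * b \<le> 0.2618 * b"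
    using pi_approx b by (intro mult_right_mono) auto
  have inK: "norm (w - w0) \<le> 0.2618 * b" "Re w \<le> 0" "pi - 0.2618 * b \<le> Im w" "Im w \<le> pi"
    "exp w \<in> slit_plane" "norm (exp w) \<le> 1" "Im (exp w) \<ge> 0" "norm (exp w + 1) \<le> 0.2618 * b"
    "Re (dilog (exp w)) \<le> - 0.224"
    if "w \<in> K" for w
  proof -
    have "norm (w - w0) \<le> pi / 12 * b" using that by (simp add: K_def dist_norm norm_minus_commute)
    then show n: "norm (w - w0) \<le> 0.2618 * b" using radius by linarith
    show re: "Re w \<le> 0" and im: "Im w \<le> pi" using that by (auto simp: K_def)
    have "\<bar>Im w - pi\<bar> \<le> norm (w - w0)" using abs_Im_le_cmod[of "w - w0"] by (simp add: w0_def)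
    then show im2: "pi - 0.2618 * b \<le> Im w" using n by linarith
    then have im3: "0 < Im w" using pi_approx(1) b by simp
    then show "exp w \<in> slit_plane" using im pi_gt_zero
      by (intro exp_in_slit_plane_strip) linarith+
    show n1: "norm (exp w) \<le> 1" using re by simp
    show "Im (exp w) \<ge> 0" using im im3 by (simp add: Im_exp sin_ge_zero)
    have "exp (w - w0) = - exp w" by (simp add: exp_diff w0_def)
    then have "norm (exp w + 1) = norm (exp (w - w0) - 1)"
      by (simp add: norm_minus_commute algebra_simps flip: norm_minus_cancel[of "- 1 - exp w"])
    also have "\<dots> \<le> norm (w - w0)" using re by (intro norm_exp_minus_1_le_norm) (simp add: w0_def)
    finally show e: "norm (exp w + 1) \<le> 0.2618 * b" using n by linarith
    have "Re (exp w) + 1 \<le> 0.2618 * b" using complex_Re_le_cmod[of "exp w + 1"] e by simp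
    moreover have "Re (dilog (exp w)) - Re (exp w) \<le> 0.645"
      using complex_Re_le_cmod[of "dilog_series (exp w) - exp w"]
        norm_dilog_series_minus_le[OF n1] pi_sq_bound n1 by (simp add: dilog_eq_series)
    ultimately show "Re (dilog (exp w)) \<le> - 0.224" using b by simp
  qed
  have "\<exists>w\<in>K. log_map A B w = w"
  proof (rule brouwer)
    show "compact K" unfolding K_def
      by (intro compact_Int_closed closed_halfspace_Re_le closed_halfspace_Im_le compact_cball)
    show "convex K" unfolding K_def
      by (intro convex_Int convex_cball convex_halfspace_Re_le convex_halfspace_Im_le)
    have "w0 \<in> K" using b by (auto simp: K_def w0_def)
    then show "K \<noteq> {}" by auto
    show "continuous_on K (log_map A B)" unfolding log_map_def
      by (intro continuous_intros continuous_at_imp_continuous_on ballI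
          DERIV_isCont[OF has_field_derivative_dilog_exp] inK)
    show "log_map A B \<in> K \<rightarrow> K"
    proof
      fix w assume w: "w \<in> K"
      have "norm (log_map A B w - w0) \<le> pi / 12 * b"
        using norm_log_map_diff_le[of B w A] inK(2)[OF w] B unfolding w0_eq b_def by simp
      moreover have "Im (dilog (exp w)) \<ge> 0"
        using inK(6,7)[OF w] by (simp only: dilog_eq_series Im_dilog_series_nonneg)
      then have "Re (log_map A B w) \<le> 0" using B by (simp add: Re_log_map)
      moreover have "Re (dilog (exp w)) / (2 * pi * of_int B) \<le> 0"
        using inK(9)[OF w] B by (intro divide_nonpos_pos) auto
      then have "Im (log_map A B w) \<le> pi"
        using \<open>real_of_int B = 2 * real_of_int A\<close> A by (simp add: Im_log_map)
      ultimately show "log_map A B w \<in> K" by (simp add: K_def dist_norm norm_minus_commute)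
    qed
  qed blast
  then obtain w where w: "w \<in> K" "log_map A B w = w" by blast
  define r where "r = exp w"
  have r_zero: "phi A B r = 0"
    unfolding r_def using inK(3,4)[OF w(1)] w B pi_approx(1) b
    by (intro phi_zero_of_log_map_fixed_point) auto
  have c_eq: "newton_seq A B 0 = - 1"
  proof -
    have "exp (2 * of_real pi * \<i> * of_int A / of_int B) = exp w0"
      unfolding w0_eq by (simp add: mult_ac)
    then show ?thesis using A by (simp add: w0_def)
  qed
  have e0: "norm (r - (- 1)) \<le> 0.2618 * b" using inK(8)[OF w(1)] by (simp add: r_def)
  \<comment> \<open>The fixed-point equation makes the angular distance from the negative axis equal
    to \<open>- Re (dilog (exp w)) * b / (2 * pi)\<close>, hence of order \<open>b\<close>. The
    bound has to exceed the radius \<open>0.022 * b\<close> of the later ball.\<close>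
  have Im_r: "Im r \<ge> 0.03 * b"
  proof -
    define \<delta> where "\<delta> = pi - Im w"
    have "Im w = pi + Re (dilog (exp w)) * b / (2 * pi)"
      using Im_log_map[of A B w] w(2) \<open>real_of_int B = 2 * real_of_int A\<close> A
      by (simp add: b_def)
    then have \<delta>: "\<delta> = - Re (dilog (exp w)) * b / (2 * pi)" by (simp add: \<delta>_def)
    have "- Re (dilog (exp w)) * b / (2 * pi) \<ge> 0.224 * b / (2 * pi)"
      using inK(9)[OF w(1)] b by (intro divide_right_mono mult_right_mono) auto
    moreover have "0.224 * b / (2 * pi) \<ge> 0.0355 * b"
      using pi_approx b by (simp add: field_simps)
    ultimately have \<delta>1: "\<delta> \<ge> 0.0355 * b" using \<delta> by linarith
    have \<delta>2: "\<delta> \<le> 0.2618 * b" using inK(3)[OF w(1)] by (simp add: \<delta>_def)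
    have \<delta>0: "\<delta> > 0" using \<delta>1 b by simp
    have "\<delta>\<^sup>2 \<le> 0.24\<^sup>2" using \<delta>2 \<delta>0 b by (intro power_mono) auto
    then have "\<delta> * \<delta>\<^sup>2 \<le> \<delta> * 0.24\<^sup>2" using \<delta>0 by (intro mult_left_mono) auto
    then have "\<delta> ^ 3 / 6 \<le> 0.01 * \<delta>" using \<delta>0 by (simp add: power3_eq_cube power2_eq_square)
    then have "0.99 * \<delta> \<le> sin \<delta>" using sin_lower_bound[of \<delta>] \<delta>0 by simp
    moreover have "exp (Re w) \<ge> 0.86"
    proof -
      have "norm (exp w) \<ge> 1 - 0.2618 * b" using norm_triangle_ineq4[of "exp w + 1" "exp w"] inK(8)[OF w(1)] by simp
      then show ?thesis using b by simp
    qed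
    ultimately have "0.86 * (0.99 * \<delta>) \<le> exp (Re w) * sin \<delta>"
      using \<delta>0 by (intro mult_mono) auto
    moreover have "Im r = exp (Re w) * sin \<delta>" by (simp add: r_def Im_exp \<delta>_def)
    ultimately show ?thesis using \<delta>1 b by simp
  qed
  have near: "Re u \<le> - 0.869" "norm u \<ge> 0.869" "norm (1 - u) \<ge> 1.8"
    if "norm (u - (- 1)) \<le> 0.2618 * b" for u
  proof -
    have "Re u + 1 \<le> 0.2618 * b" using complex_Re_le_cmod[of "u + 1"] that by simp
    then show re: "Re u \<le> - 0.869" using b by simp
    then show "norm u \<ge> 0.869" using abs_Re_le_cmod[of u] by simp
    show "norm (1 - u) \<ge> 1.8" using complex_Re_le_cmod[of "1 - u"] re by simp
  qed
  have seg: "norm (u - (- 1)) \<le> 0.2618 * b" if "u \<in> closed_segment (- 1) r" for u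
    using segment_bound(1)[OF that] e0 by (simp add: norm_minus_commute)
  have slit: "u \<in> slit_plane" "Re u \<noteq> 0" if "u \<in> closed_segment (- 1) r" for u
    using near(1)[OF seg[OF that]] by (auto simp: slit_plane_iff complex_nonpos_Reals_iff)
  \<comment> \<open>The segment of the first step starts on the cut of \<open>phi\<close>. Both its
    endpoints are in the closed upper half-plane, so the first iterate is unchanged; later steps
    avoid the real axis and use \<open>phi\<close> itself.\<close>
  have rot: "phi_rotated A B r = 0" "phi_rotated A B (- 1) = phi A B (- 1)"
    using r_zero Im_r b by (auto simp: phi_rotated_eq_phi r_def)
  have "norm (r - (- 1 - phi_rotated A B (- 1) / phi_deriv A B (- 1)))
      \<le> 1 / (2 * 0.869) * (1 + norm (- 1 :: complex) / (pi * (1.8 * of_int B))) * (norm (r - (- 1)))\<^sup>2"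
    by (rule newton_step)
      (use B near[OF seg] slit rot in \<open>auto intro: phi_rotated_has_field_derivative\<close>)
  also have "\<dots> \<le> 0.63 * (0.2618 * b)\<^sup>2"
  proof (rule mult_mono)
    have "pi * (1.8 * of_int B) \<ge> 3.14 * (1.8 * 2)"
      using pi_approx B by (intro mult_mono) auto
    then have "1 / (pi * (1.8 * of_int B)) \<le> 1 / (3.14 * (1.8 * 2))"
      by (intro divide_left_mono) auto
    then show "1 / (2 * 0.869) * (1 + norm (- 1 :: complex) / (pi * (1.8 * of_int B))) \<le> 0.63"
      by simp
    show "(norm (r - (- 1)))\<^sup>2 \<le> (0.2618 * b)\<^sup>2" using e0 by (intro power_mono) auto
  qed auto
  also have "\<dots> \<le> 0.022 * b"
    using b by (simp add: power2_eq_square)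
  finally have "norm (r - (- 1 - phi A B (- 1) / phi_deriv A B (- 1))) \<le> 0.022 * b"
    unfolding rot .
  then have e1: "norm (r - newton_seq A B 1) \<le> 0.022 * b"
    by (simp only: One_nat_def newton_seq.simps(2) c_eq)
  \<comment> \<open>Near -1 the distance to 1 is bounded below, so \<open>h\<close> may be a
    multiple of \<open>B\<close>. The critical constraint is that the ball of radius
    \<open>0.022 * b\<close> stays above the real axis.\<close>
  show ?thesis
  proof (rule newton_tail[where r = r and m = "4 / 5" and h = "3 / 2 * of_int B" and \<epsilon> = "22 / 1000 * b"
        and M = "6 / 5" and K = "9 / 10"])
    show "norm (r - newton_seq A B 0) < 1.18" unfolding c_eq using e0 b by simp
    have "norm r \<le> 1" unfolding r_def by (rule inK(6)[OF w(1)])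
    then show "norm r + 22 / 1000 * b \<le> 6 / 5" using b by linarith
    have "pi * (3 / 2 * of_int B) \<ge> 3 * (3 / 2 * 2)"
      using pi_approx B by (intro mult_mono) auto
    then have "6 / 5 / (pi * (3 / 2 * of_int B)) \<le> 6 / 5 / (3 * (3 / 2 * 2))"
      by (intro divide_left_mono) auto
    then show "1 / (2 * (4 / 5)) * (1 + 6 / 5 / (pi * (3 / 2 * of_int B))) \<le> 9 / 10" by simp
    fix u assume u: "norm (u - r) \<le> 22 / 1000 * b"
    have "Im u > 0" using abs_Im_le_cmod[of "u - r"] u Im_r b by simp
    then show "Im u \<noteq> 0" by simp
    have re: "Re u \<le> - 0.84" using complex_Re_le_cmod[of "u - r"] u near(1)[OF e0] b by simp
    show "norm (1 - u) \<ge> 3 / 2 * of_int B / of_int B"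
      using complex_Re_le_cmod[of "1 - u"] re B by simp
    show "norm u \<ge> 4 / 5" using abs_Re_le_cmod[of u] re by simp
  qed (use B r_zero b e1 in auto)
qed

section \<open>The case \<open>A = 0\<close>: logarithmic estimates at the branch point\<close>

text \<open>Needed for the primitive of \<open>ln\<close> at 0. The inequality
  \<open>ln (1 / sqrt x) <= 1 / sqrt x - 1\<close> bounds \<open>- x ln x\<close> by
  \<open>2 sqrt x\<close> for \<open>0 < x < 1\<close>.\<close>

lemma continuous_on_x_ln_x: "continuous_on {0..} (\<lambda>x::real. x * ln x)"
  unfolding continuous_on_eq_continuous_within
proof
  fix x :: real assume x: "x \<in> {0..}"
  show "continuous (at x within {0..}) (\<lambda>x. x * ln x)"
  proof (cases "x = 0")
    case False
    then show ?thesis using x by (intro continuous_intros) auto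
  next
    case True
    have lim: "((\<lambda>x::real. sqrt x * 2 + x) \<longlongrightarrow> 0) (at 0 within {0..})"
      by (auto intro!: tendsto_eq_intros)
    have "norm (x * ln x) \<le> sqrt x * 2 + x" if "x \<ge> 0" "x < 1" for x :: real
    proof (cases "x = 0")
      case False
      then have x: "x > 0" using that by simp
      then have "ln (1 / sqrt x) \<le> 1 / sqrt x - 1" by (intro ln_le_minus_one) simp
      moreover have "ln (1 / sqrt x) = - ln x / 2" using x by (simp add: ln_div ln_sqrt)
      ultimately have "x * (- ln x) \<le> x * (2 * (1 / sqrt x))"
        using x by (intro mult_left_mono) auto
      also have "\<dots> = 2 * (x / sqrt x)" by simp
      also have "\<dots> = 2 * sqrt x" using x by (simp add: real_div_sqrt del: times_divide_eq_right)
      finally show ?thesis using x that by (simp add: abs_mult)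
    qed simp
    then have "eventually (\<lambda>x. norm (x * ln x) \<le> sqrt x * 2 + x) (at (0::real) within {0..})"
      unfolding eventually_at by (intro exI[of _ 1]) (auto simp: dist_real_def)
    then have "((\<lambda>x::real. x * ln x) \<longlongrightarrow> 0) (at 0 within {0..})"
      by (rule Lim_null_comparison[OF _ lim])
    then show ?thesis using True by (simp add: continuous_within)
  qed
qed

text \<open>The right-hand side is the tangent at \<open>k\<close> to the concave function
  \<open>- x ln x\<close>; it is sharp when \<open>k\<close> is chosen close to
  \<open>x\<close>.\<close>

lemma neg_x_ln_x_le:
  fixes x k :: real
  assumes "x > 0" "k > 0"
  shows "- x * ln x \<le> - x * ln k - x + k"
proof -
  have "ln (k / x) \<le> k / x - 1" using assms by (intro ln_le_minus_one) simp
  then have "x * (ln k - ln x) \<le> x * (k / x - 1)" using assms by (simp add: ln_div)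
  then show ?thesis using assms by (simp add: algebra_simps)
qed

text \<open>On the left half-plane \<open>exp v - 1 - v\<close> is at most \<open>|v|^2\<close>,
  which takes away at most the fraction \<open>0.27\<close> of \<open>|v|\<close>.\<close>

lemma norm_1_minus_exp_ge:
  fixes v :: complex
  assumes "Re v \<le> 0" "norm v \<le> 27 / 100"
  shows "norm (1 - exp v) \<ge> 73 / 100 * norm v"
proof -
  have "norm ((exp v - v) - (exp 0 - 0)) \<le> norm v * norm (v - 0)"
  proof (rule field_differentiable_bound[where S = "{z. Re z \<le> 0} \<inter> cball 0 (norm v)" and f' = "\<lambda>z. exp z - 1"])
    show "convex ({z. Re z \<le> 0} \<inter> cball 0 (norm v))"
      by (intro convex_Int convex_halfspace_Re_le convex_cball)
    show "norm (exp z - 1) \<le> norm v" if "z \<in> {z. Re z \<le> 0} \<inter> cball 0 (norm v)" for z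
      using norm_exp_minus_1_le_norm[of z] that by auto
    show "((\<lambda>z. exp z - z) has_field_derivative exp z - 1) (at z within {z. Re z \<le> 0} \<inter> cball 0 (norm v))" for z :: complex
      by (auto intro!: derivative_eq_intros)
  qed (use assms in auto)
  then have "norm ((exp v - 1) - v) \<le> norm v * norm v" by (simp add: algebra_simps)
  also have "\<dots> \<le> 27 / 100 * norm v" using assms by (intro mult_right_mono) auto
  finally have "norm v - 27 / 100 * norm v \<le> norm (exp v - 1)"
    using norm_triangle_ineq2[of v "exp v - 1"] by (simp add: norm_minus_commute)
  then show ?thesis by (simp add: norm_minus_commute)
qed

text \<open>\<open>1 - exp v\<close> lies in the open fourth quadrant, which bounds the argument.
  The constant comes from \<open>- ln (73/100) <= 100/73 - 1 < 37/100\<close>.\<close>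

lemma Ln_1_minus_exp_bounds:
  assumes v: "Re v \<le> 0" "0 < Im v" "norm v \<le> 27 / 100"
  shows "- Re (Ln (1 - exp v)) \<le> 37 / 100 - ln (norm v)"
    and "0 \<le> - Im (Ln (1 - exp v))" "- Im (Ln (1 - exp v)) \<le> pi / 2"
proof -
  have nv: "norm v > 0" using v by auto
  have "Im v < pi" using abs_Im_le_cmod[of v] v pi_approx(1) by simp
  then have im: "Im (1 - exp v) < 0" using v by (simp add: Im_exp sin_gt_zero)
  then have nz: "1 - exp v \<noteq> 0" by auto
  have "norm (exp v) \<le> 1" using v by simp
  then have "Re (exp v) \<noteq> 1"
    using im by (auto simp: cmod_def power2_eq_square mult_le_0_iff)
  then have re: "Re (1 - exp v) > 0" using \<open>norm (exp v) \<le> 1\<close> complex_Re_le_cmod[of "exp v"]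
    unfolding minus_complex.sel one_complex.sel by linarith
  have "\<bar>Im (Ln (1 - exp v))\<bar> < pi / 2" using Re_Ln_pos_lt[OF nz] re by simp
  moreover have "\<not> (0 < Im (Ln (1 - exp v)) \<and> Im (Ln (1 - exp v)) < pi)"
    using Im_Ln_pos_lt[OF nz] im by simp
  ultimately show "0 \<le> - Im (Ln (1 - exp v))" "- Im (Ln (1 - exp v)) \<le> pi / 2"
    using pi_gt_zero by linarith+
  have "ln (norm v) + ln (73 / 100) = ln (73 / 100 * norm v)" using nv ln_mult[of "73 / 100" "norm v"] by simp
  also have "\<dots> \<le> ln (norm (1 - exp v))"
    using norm_1_minus_exp_ge[OF v(1,3)] nv nz by (subst ln_le_cancel_iff) auto
  also have "\<dots> = Re (Ln (1 - exp v))" using nz by simp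
  finally have "ln (norm v) + ln (73 / 100) \<le> Re (Ln (1 - exp v))" .
  moreover have "ln (100 / 73 :: real) \<le> 100 / 73 - 1" by (intro ln_le_minus_one) simp
  then have "- ln (73 / 100 :: real) \<le> 37 / 100" by (simp add: ln_div)
  ultimately show "- Re (Ln (1 - exp v)) \<le> 37 / 100 - ln (norm v)" by linarith
qed

text \<open>Integrates the bounds on \<open>Ln (1 - exp v)\<close> along the ray from \<open>0\<close> to \<open>w\<close>; the constant is
  \<open>37/100\<close> plus the integral of \<open>- ln t\<close>.\<close>
lemma dilog_series_exp_bounds:
  assumes w: "Re w \<le> 0" "0 < Im w" "norm w \<le> 27 / 100"
  shows "Im (dilog_series (exp w)) \<le> Im w * (137 / 100 - ln (norm w))"
    and "pi\<^sup>2 / 6 + Re w * (137 / 100 - ln (norm w)) - Im w * (pi / 2) \<le> Re (dilog_series (exp w))"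
proof -
  define F where "F t = dilog_series (exp (of_real t * w))" for t :: real
  \<comment> \<open>The primitive of \<open>37/100 - ln (norm (t w))\<close> that vanishes at 0, in
    closed form.\<close>
  define q where "q t = t * (137 / 100 - ln (norm w)) - t * ln t" for t :: real
  have w0: "w \<noteq> 0" using w by auto
  have contF: "continuous_on {0..1} F" unfolding F_def
    using w by (intro continuous_on_compose2[OF continuous_on_dilog_series] continuous_intros)
      (auto simp: mult_nonneg_nonpos)
  have contq: "continuous_on {0..1} q" unfolding q_def
    by (intro continuous_intros continuous_on_subset[OF continuous_on_x_ln_x]) auto
  have F: "((\<lambda>t. Re (F t)) has_real_derivative (- Re w * Re (Ln (1 - exp (of_real t * w))) + Im w * Im (Ln (1 - exp (of_real t * w))))) (at t)"
      "((\<lambda>t. Im (F t)) has_real_derivative (- Re w * Im (Ln (1 - exp (of_real t * w))) - Im w * Re (Ln (1 - exp (of_real t * w))))) (at t)"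
    if t: "0 < t" "t < 1" for t
  proof -
    have "((\<lambda>t. of_real t * w) has_vector_derivative w) (at t)"
      by (auto intro!: derivative_eq_intros)
    moreover have "exp (of_real t * w) \<in> slit_plane"
    proof (rule exp_in_slit_plane_strip)
      have "t * Im w \<le> Im w" using t w by (intro mult_left_le_one_le) auto
      also have "Im w \<le> 27 / 100" using abs_Im_le_cmod[of w] w by linarith
      also have "\<dots> < 2 * pi" using pi_approx(1) by simp
      finally show "\<bar>Im (of_real t * w)\<bar> < 2 * pi" using t w by simp
      show "0 < \<bar>Im (of_real t * w)\<bar>" using t w by simp
    qed
    ultimately have "((\<lambda>t. dilog (exp (of_real t * w))) has_vector_derivative
        (w * (- Ln (1 - exp (of_real t * w))))) (at t)"
      using field_vector_diff_chain_at[OF _ has_field_derivative_dilog_exp] by (fastforce simp: o_def)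
    then have vd: "(F has_vector_derivative (w * (- Ln (1 - exp (of_real t * w))))) (at t)"
      by (rule has_vector_derivative_transform_within_open[where S = "{0<..<1}"])
        (use t w in \<open>auto simp: F_def dilog_eq_series mult_nonneg_nonpos\<close>)
    show "((\<lambda>t. Re (F t)) has_real_derivative (- Re w * Re (Ln (1 - exp (of_real t * w))) + Im w * Im (Ln (1 - exp (of_real t * w))))) (at t)"
      using bounded_linear.has_vector_derivative[OF bounded_linear_Re vd]
      by (simp add: has_real_derivative_iff_has_vector_derivative)
    show "((\<lambda>t. Im (F t)) has_real_derivative (- Re w * Im (Ln (1 - exp (of_real t * w))) - Im w * Re (Ln (1 - exp (of_real t * w))))) (at t)"
      using bounded_linear.has_vector_derivative[OF bounded_linear_Im vd]
      by (simp add: has_real_derivative_iff_has_vector_derivative)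
  qed
  have q: "(q has_real_derivative (37 / 100 - ln (norm (of_real t * w)))) (at t)" if t: "0 < t" "t < 1" for t
  proof -
    have "(q has_real_derivative ((137 / 100 - ln (norm w)) - (t * (1 / t) + ln t))) (at t)"
      unfolding q_def using t by (auto intro!: derivative_eq_intros)
    moreover have "ln (norm (of_real t * w)) = ln t + ln (norm w)"
      using t w0 by (simp add: norm_mult ln_mult)
    ultimately show ?thesis using t by (simp add: algebra_simps)
  qed
  have bd: "- Re (Ln (1 - exp (of_real t * w))) \<le> 37 / 100 - ln (norm (of_real t * w))"
    "0 \<le> - Im (Ln (1 - exp (of_real t * w)))" "- Im (Ln (1 - exp (of_real t * w))) \<le> pi / 2"
    if t: "0 < t" "t < 1" for t :: real
  proof -
    have "norm (of_real t * w) \<le> 27 / 100"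
      using t w mult_le_one[of t "norm w"] mult_right_le_one_le[of "norm w" t] by (simp add: norm_mult mult.commute)
    then have "Re (of_real t * w) \<le> 0" "0 < Im (of_real t * w)" "norm (of_real t * w) \<le> 27 / 100"
      using t w by (auto simp: mult_nonneg_nonpos)
    note Ln_1_minus_exp_bounds[OF this]
    then show "- Re (Ln (1 - exp (of_real t * w))) \<le> 37 / 100 - ln (norm (of_real t * w))"
    "0 \<le> - Im (Ln (1 - exp (of_real t * w)))" "- Im (Ln (1 - exp (of_real t * w))) \<le> pi / 2" by auto
  qed
  have F01: "F 0 = of_real (pi\<^sup>2 / 6)" "F 1 = dilog_series (exp w)" by (simp_all add: F_def dilog_series_1)
  have q01: "q 0 = 0" "q 1 = 137 / 100 - ln (norm w)" by (simp_all add: q_def)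
  have "Im w * q 0 - Im (F 0) \<le> Im w * q 1 - Im (F 1)"
  proof (rule DERIV_nonneg_imp_increasing_open[where a = 0 and b = 1 and f = "\<lambda>t. Im w * q t - Im (F t)"])
    show "continuous_on {0..1} (\<lambda>t. Im w * q t - Im (F t))"
      by (intro continuous_intros contq contF)
    fix t :: real assume t: "0 < t" "t < 1"
    let ?L = "Ln (1 - exp (of_real t * w))"
    have "Im w * (- Re ?L) \<le> Im w * (37 / 100 - ln (norm (of_real t * w)))"
      using w bd[OF t] by (intro mult_left_mono) auto
    moreover have "Re w * (- Im ?L) \<le> 0" using w bd[OF t] by (intro mult_nonpos_nonneg) auto
    ultimately have "0 \<le> Im w * (37 / 100 - ln (norm (of_real t * w))) - (- Re w * Im ?L - Im w * Re ?L)"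
      by simp
    then show "\<exists>y. ((\<lambda>t. Im w * q t - Im (F t)) has_real_derivative y) (at t) \<and> y \<ge> 0"
      using DERIV_diff[OF DERIV_cmult[OF q[OF t]] F(2)[OF t]] by blast
  qed simp
  then show "Im (dilog_series (exp w)) \<le> Im w * (137 / 100 - ln (norm w))"
    by (simp add: F01 q01 flip: of_real_power)
  have "Re (F 0) - Re w * q 0 + Im w * (pi / 2) * 0 \<le> Re (F 1) - Re w * q 1 + Im w * (pi / 2) * 1"
  proof (rule DERIV_nonneg_imp_increasing_open[where a = 0 and b = 1
        and f = "\<lambda>t. Re (F t) - Re w * q t + Im w * (pi / 2) * t"])
    show "continuous_on {0..1} (\<lambda>t. Re (F t) - Re w * q t + Im w * (pi / 2) * t)"
      by (intro continuous_intros contq contF)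
    fix t :: real assume t: "0 < t" "t < 1"
    let ?L = "Ln (1 - exp (of_real t * w))"
    have "Re w * (37 / 100 - ln (norm (of_real t * w))) \<le> Re w * (- Re ?L)"
      using w bd[OF t] by (intro mult_left_mono_neg) auto
    moreover have "Im w * (- Im ?L) \<le> Im w * (pi / 2)" using w bd[OF t] by (intro mult_left_mono) auto
    ultimately have "0 \<le> (- Re w * Re ?L + Im w * Im ?L) - Re w * (37 / 100 - ln (norm (of_real t * w)))
        + Im w * (pi / 2)" by simp
    moreover have "((\<lambda>t. Re (F t) - Re w * q t + Im w * (pi / 2) * t) has_real_derivative
        ((- Re w * Re ?L + Im w * Im ?L) - Re w * (37 / 100 - ln (norm (of_real t * w)))
        + Im w * (pi / 2))) (at t)"
      using DERIV_add[OF DERIV_diff[OF F(1)[OF t] DERIV_cmult[OF q[OF t], where c = "Re w"]]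
          DERIV_cmult[OF DERIV_ident, where c = "Im w * (pi / 2)"]]
      by (simp only: mult_1_right)
    ultimately show "\<exists>y. ((\<lambda>t. Re (F t) - Re w * q t + Im w * (pi / 2) * t) has_real_derivative y) (at t) \<and> y \<ge> 0"
      by blast
  qed simp
  moreover have "Re (F 0) = pi\<^sup>2 / 6" unfolding F01(1) by (rule Re_complex_of_real)
  ultimately show "pi\<^sup>2 / 6 + Re w * (137 / 100 - ln (norm w)) - Im w * (pi / 2) \<le> Re (dilog_series (exp w))"
    unfolding F01(2) q01 by linarith
qed

lemma newton_case_zero:
  assumes B: "B \<ge> 1"
  shows "newton_seq 0 B \<longlonglongrightarrow> phi_zero 0 B \<and>
    (\<forall>n. norm (phi_zero 0 B - newton_seq 0 B n) < 1.25 * 0.95 ^ (2 ^ n))"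
proof -
  define b where "b = 1 / real_of_int B"
  \<comment> \<open>This set contains 0, where \<open>exp w = 1\<close> is the branch point.
    Continuity up to there is provided by the series; nonnegative imaginary and positive real parts
    of the dilogarithm preserve the two half-planes.\<close>
  define K where "K = cball (0::complex) (pi / 12 * b) \<inter> {w. Re w \<le> 0} \<inter> {w. Im w \<ge> 0}"
  have b: "b > 0" "b \<le> 1" "real_of_int B = 1 / b"
    using B by (auto simp: b_def field_simps)
  have radius: "pi / 12 * b \<le> 0.2618 * b"
    using pi_approx b by (intro mult_right_mono) auto
  have radius1: "pi / 12 * b \<le> 0.2618"
  proof -
    have "pi / 12 * b \<le> 0.2618 * 1"
      using radius by (rule order_trans) (intro mult_left_mono b, simp)
    then show ?thesis by simp
  qed
  have inK: "norm w \<le> 0.2618 * b" "Re w \<le> 0" "0 \<le> Im w" "Im w \<le> pi / 12 * b"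
    "norm (exp w) \<le> 1" "Im (exp w) \<ge> 0" "norm (exp w - 1) \<le> 0.2618 * b"
    "Re (dilog (exp w)) \<ge> 0.09"
    if "w \<in> K" for w
  proof -
    have n: "norm w \<le> pi / 12 * b" using that by (simp add: K_def)
    then show n2: "norm w \<le> 0.2618 * b" using radius by linarith
    show re: "Re w \<le> 0" and im: "0 \<le> Im w" using that by (auto simp: K_def)
    show "Im w \<le> pi / 12 * b" using abs_Im_le_cmod[of w] n by linarith
    have "Im w \<le> pi" using abs_Im_le_cmod[of w] n2 b pi_approx(1) by simp
    show n1: "norm (exp w) \<le> 1" using re by simp
    show "Im (exp w) \<ge> 0" using im \<open>Im w \<le> pi\<close> by (simp add: Im_exp sin_ge_zero)
    show e: "norm (exp w - 1) \<le> 0.2618 * b"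
      using norm_exp_minus_1_le_norm[OF re] n2 by linarith
    have "1 - Re (exp w) \<le> 0.2618 * b"
      using complex_Re_le_cmod[of "1 - exp w"] e by (simp add: norm_minus_commute)
    moreover have "Re (exp w) - Re (dilog (exp w)) \<le> 0.645"
      using complex_Re_le_cmod[of "exp w - dilog_series (exp w)"]
        norm_dilog_series_minus_le[OF n1] pi_sq_bound n1
      by (simp add: dilog_eq_series norm_minus_commute)
    ultimately show "Re (dilog (exp w)) \<ge> 0.09" using b by simp
  qed
  have "\<exists>w\<in>K. log_map 0 B w = w"
  proof (rule brouwer)
    show "compact K" unfolding K_def
      by (intro compact_Int_closed closed_halfspace_Re_le closed_halfspace_Im_ge compact_cball)
    show "convex K" unfolding K_def
      by (intro convex_Int convex_cball convex_halfspace_Re_le convex_halfspace_Im_ge)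
    have "0 \<in> K" using b by (auto simp: K_def)
    then show "K \<noteq> {}" by auto
    have "continuous_on K (\<lambda>w. dilog_series (exp w))"
      by (intro continuous_on_compose2[OF continuous_on_dilog_series] continuous_intros)
        (use inK(5) in auto)
    then have "continuous_on K (\<lambda>w. dilog (exp w))"
      by (rule continuous_on_eq) (use inK(5) in \<open>simp add: dilog_eq_series\<close>)
    then show "continuous_on K (log_map 0 B)" unfolding log_map_def by (intro continuous_intros)
    show "log_map 0 B \<in> K \<rightarrow> K"
    proof
      fix w assume w: "w \<in> K"
      have "norm (log_map 0 B w) \<le> pi / 12 * b"
        using norm_log_map_diff_le[of B w 0] inK(2)[OF w] B unfolding b_def by simp
      moreover have "Im (dilog (exp w)) \<ge> 0"
        using inK(5,6)[OF w] by (simp only: dilog_eq_series Im_dilog_series_nonneg)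
      then have "Re (log_map 0 B w) \<le> 0" using B by (simp add: Re_log_map)
      moreover have "Re (dilog (exp w)) / (2 * pi * of_int B) \<ge> 0"
        using inK(8)[OF w] B by (intro divide_nonneg_pos) auto
      then have "Im (log_map 0 B w) \<ge> 0" by (simp add: Im_log_map)
      ultimately show "log_map 0 B w \<in> K" by (simp add: K_def)
    qed
  qed blast
  then obtain w where w: "w \<in> K" "log_map 0 B w = w" by blast
  note w_facts = inK[OF w(1)]
  define S where "S = dilog_series (exp w)"
  define X where "X = - Re w"
  define y where "y = Im w"
  have dilog_w: "dilog (exp w) = S" using w_facts(5) by (simp add: dilog_eq_series S_def)
  have X_eq: "X = Im S * b / (2 * pi)" and y_eq: "y = Re S * b / (2 * pi)"
    using Re_log_map[of 0 B w] Im_log_map[of 0 B w] w(2) dilog_w by (simp_all add: X_def y_def b_def)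
  have X0: "X \<ge> 0" using w_facts(2) by (simp add: X_def)
  have y0: "y > 0" unfolding y_eq using w_facts(8) dilog_w b by (intro divide_pos_pos mult_pos_pos) auto
  have y_le: "y \<le> 0.2618 * b" using w_facts(4) radius by (simp add: y_def)
  have norm_w: "norm w \<le> 27 / 100" using w_facts(1) b by simp
  have nw0: "norm w > 0" "norm w \<ge> y" "norm w \<ge> X"
    using y0 abs_Im_le_cmod[of w] abs_Re_le_cmod[of w] by (auto simp: y_def X_def)
  have S_bounds: "Im S \<le> y * (137 / 100 - ln (norm w))"
    "pi\<^sup>2 / 6 - X * (137 / 100 - ln (norm w)) - y * (pi / 2) \<le> Re S"
    using dilog_series_exp_bounds[of w] w_facts(2) y0 norm_w by (simp_all add: S_def X_def y_def)
  have ln2: "ln 2 \<le> (25 / 36 :: real)" by (rule ln2_le_25_over_36)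
  \<comment> \<open>A bootstrap starts here: the crude bound on \<open>y\<close> limits
    \<open>Im S\<close>, hence \<open>X\<close>; this limits the loss in \<open>Re S\<close>, and so
    bounds \<open>y\<close> from below, away from the branch point.\<close>
  have Im_S: "Im S \<le> 0.711"
  proof -
    have "ln y \<le> ln (norm w)" using nw0 y0 by simp
    then have "y * (137 / 100 - ln (norm w)) \<le> y * (137 / 100 - ln y)"
      using y0 by (intro mult_left_mono) auto
    \<comment> \<open>The tangent point \<open>b / 4\<close> is near the expected size
      \<open>pi/12 * b\<close> of \<open>y\<close>. The resulting term \<open>y / b\<close> is
      harmless because \<open>y <= 0.2618 * b\<close>.\<close>
    moreover have "- y * ln y \<le> - y * ln (b / 4) - y + b / 4" using y0 b by (intro neg_x_ln_x_le) auto
    moreover have "- ln (b / 4) \<le> 1 / b - 1 + 25 / 18"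
    proof -
      have "ln (1 / b) \<le> 1 / b - 1" using b by (intro ln_le_minus_one) simp
      moreover have "ln (4::real) = 2 * ln 2" using ln_realpow[of 2 2] by simp
      ultimately show ?thesis using b ln2 by (simp add: ln_div)
    qed
    then have "y * (- ln (b / 4)) \<le> y * (1 / b - 1 + 25 / 18)" using y0 by (intro mult_left_mono) auto
    moreover define E where "E = 1 / b + 137 / 100 - 2 + 25 / 18"
    have "y * E \<le> 0.2618 * b * E"
      using y_le b by (intro mult_right_mono) (auto simp: E_def field_simps)
    moreover have "0.2618 * b * E + b / 4 \<le> 0.711"
      using b by (simp add: E_def field_simps)
    moreover have "y * E = y * (137 / 100) + y * (1 / b - 1 + 25 / 18) - y"
      "y * (137 / 100 - ln y) = y * (137 / 100) + (- y * ln y)"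
      "- y * ln (b / 4) = y * (- ln (b / 4))"
      by (simp_all add: E_def algebra_simps)
    ultimately have "Im S \<le> 0.711"
      using S_bounds(1) by argo
    then show ?thesis .
  qed
  have X_le: "X \<le> 0.1133 * b"
  proof -
    have "X \<le> 0.711 * b / (2 * pi)"
      unfolding X_eq using Im_S b by (intro divide_right_mono mult_right_mono) auto
    also have "\<dots> \<le> 0.1133 * b" using pi_approx b by (simp add: field_simps)
    finally show ?thesis .
  qed
  have Xa: "X * (137 / 100 - ln (norm w)) \<le> 0.404"
  proof (cases "X = 0")
    case False
    then have X: "X > 0" using X0 by simp
    then have "ln X \<le> ln (norm w)" using nw0 by simp
    then have "X * (137 / 100 - ln (norm w)) \<le> X * (137 / 100 - ln X)"
      using X by (intro mult_left_mono) auto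
    \<comment> \<open>The tangent point \<open>1 / 8\<close> is just above 0.1133, the largest
      possible value of \<open>X\<close>.\<close>
    moreover have "- X * ln X \<le> - X * ln (1 / 8) - X + 1 / 8" using X by (intro neg_x_ln_x_le) auto
    moreover have "- ln (1 / 8 :: real) \<le> 25 / 12" using ln_realpow[of 2 3] ln2 by (simp add: ln_div)
    then have "X * (- ln (1 / 8)) \<le> X * (25 / 12)" using X by (intro mult_left_mono) auto
    moreover have "X \<le> 0.1133" using X_le b by simp
    ultimately show ?thesis by (simp add: algebra_simps)
  qed simp
  \<comment> \<open>Since \<open>Re S = 2 * pi * y / b\<close>, the lower bound for
    \<open>Re S\<close> becomes linear in \<open>y\<close>. The constants are
    \<open>1.24 = 1.644 - 0.404\<close> and \<open>7.855 > 5 * pi / 2\<close>.\<close>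
  have y_ge: "y \<ge> 0.157 * b"
  proof -
    have "1.644 \<le> pi\<^sup>2 / 6"
    proof -
      have "3.141\<^sup>2 \<le> pi\<^sup>2" using pi_approx by (intro power_mono) auto
      then show ?thesis by (simp add: power2_eq_square)
    qed
    then have "1.24 \<le> Re S + y * (pi / 2)" using S_bounds(2) Xa by simp
    moreover have "Re S = y * (2 * pi / b)" using b y_eq by simp
    ultimately have "1.24 \<le> y * (2 * pi / b + pi / 2)" by (simp add: algebra_simps)
    also have "\<dots> \<le> y * (7.855 / b)"
    proof (rule mult_left_mono)
      have "2 * pi + pi / 2 * b \<le> 2 * pi + pi / 2 * 1" using b by (intro add_left_mono mult_left_mono) auto
      also have "\<dots> \<le> 7.855" using pi_approx by simp
      finally have "(2 * pi + pi / 2 * b) / b \<le> 7.855 / b" using b by (intro divide_right_mono) auto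
      then show "2 * pi / b + pi / 2 \<le> 7.855 / b" using b by (simp add: add_divide_distrib)
    qed (use y0 in simp)
    finally show ?thesis using b by (simp add: field_simps)
  qed
  define r where "r = exp w"
  define w0 where "w0 = \<i> * complex_of_real (pi / 12 * b)"
  define c where "c = exp w0"
  have "Im w \<le> pi" using y_le b pi_approx(1) by (simp add: y_def)
  then have r_zero: "phi 0 B r = 0"
    unfolding r_def using y0 w(2) B
    by (intro phi_zero_of_log_map_fixed_point) (auto simp: y_def)
  have c_eq: "newton_seq 0 B 0 = c"
    by (simp add: c_def w0_def b_def mult_ac)
  have nc: "norm c = 1" by (simp add: c_def w0_def)
  have e0_sq: "(norm (r - c))\<^sup>2 \<le> 0.024 * b\<^sup>2"
  proof -
    have "r - c = c * (exp (w - w0) - 1)" by (simp add: r_def c_def exp_diff algebra_simps)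
    then have "norm (r - c) = norm (exp (w - w0) - 1)" using nc by (simp add: norm_mult)
    also have "\<dots> \<le> norm (w - w0)"
      using w_facts(2) by (intro norm_exp_minus_1_le_norm) (simp add: w0_def)
    finally have "(norm (r - c))\<^sup>2 \<le> (norm (w - w0))\<^sup>2" by (intro power_mono) auto
    also have "\<dots> = X\<^sup>2 + (pi / 12 * b - y)\<^sup>2"
      by (simp add: cmod_power2 w0_def X_def y_def power2_commute)
    \<comment> \<open>\<open>0.1048 = 0.2618 - 0.157\<close>, from the two bounds that enclose
      \<open>y\<close>.\<close>
    also have "\<dots> \<le> (0.1133 * b)\<^sup>2 + (0.1048 * b)\<^sup>2"
      using X0 X_le w_facts(4) y_ge radius by (intro add_mono power_mono) (auto simp: y_def)
    also have "\<dots> \<le> 0.024 * b\<^sup>2" by (simp add: power_mult_distrib power2_eq_square)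
    finally show ?thesis .
  qed
  have sin_ge: "0.98 * t \<le> sin t" if "0 \<le> t" "t \<le> 0.2618" for t :: real
  proof -
    have "t\<^sup>2 \<le> 0.2618\<^sup>2" using that by (intro power_mono) auto
    then have "t * t\<^sup>2 \<le> t * 0.2618\<^sup>2" using that by (intro mult_left_mono) auto
    then have "t ^ 3 / 6 \<le> 0.02 * t" using that by (simp add: power3_eq_cube power2_eq_square)
    then show ?thesis using sin_lower_bound[of t] that by simp
  qed
  have Im_c: "Im c \<ge> 0.136 * b"
  proof -
    have "0.136 * b \<le> 0.98 * (0.25 * b)" using b by simp
    also have "\<dots> \<le> 0.98 * (pi / 12 * b)"
      using pi_approx b by (intro mult_left_mono mult_right_mono) auto
    also have "\<dots> \<le> sin (pi / 12 * b)" using radius1 b by (intro sin_ge) auto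
    also have "\<dots> = Im c" by (simp add: c_def w0_def Im_exp)
    finally show ?thesis .
  qed
  have Im_r: "Im r \<ge> 0.136 * b"
  proof -
    have "exp (Re w) \<ge> 0.8866"
      using X_le b by (intro order_trans[OF _ exp_ge_add_one_self]) (simp add: X_def)
    moreover have "0.98 * y \<le> sin y" using y0 y_le b by (intro sin_ge) auto
    ultimately have "0.8866 * (0.98 * y) \<le> exp (Re w) * sin y" using y0 by (intro mult_mono) auto
    then show ?thesis using y_ge b by (simp add: r_def Im_exp y_def)
  qed
  have c_near: "norm (c - 1) \<le> 0.2618"
  proof -
    have "norm (c - 1) \<le> norm w0" unfolding c_def by (intro norm_exp_minus_1_le_norm) (simp add: w0_def)
    also have "norm w0 = pi / 12 * b" using b by (simp add: w0_def norm_mult)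
    finally show ?thesis using radius1 by linarith
  qed
  have r_near: "norm (r - 1) \<le> 0.2618" using w_facts(7) b by (simp add: r_def)
  have bB: "h / of_int B = h * b" for h :: real by (simp add: b_def)
  have near: "norm u \<ge> 0.738" "norm (1 - u) \<ge> 0.136 / of_int B" "Im u > 0"
    if "u \<in> closed_segment c r" for u
  proof -
    \<comment> \<open>Both endpoints lie in this convex set, so the height above the real axis is
      not lost along the segment, as it would be in a disc about \<open>c\<close>.\<close>
    have "closed_segment c r \<subseteq> {z. Im z \<ge> 0.136 * b} \<inter> cball 1 0.2618"
      using Im_c Im_r c_near r_near
      by (intro closed_segment_subset convex_Int convex_halfspace_Im_ge convex_cball)
        (auto simp: dist_norm norm_minus_commute)
    then have u: "Im u \<ge> 0.136 * b" "norm (1 - u) \<le> 0.2618" using that by (auto simp: dist_norm)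
    then show "Im u > 0" using b by (auto intro: less_le_trans[rotated])
    show "norm (1 - u) \<ge> 0.136 / of_int B"
      unfolding bB using abs_Im_le_cmod[of "1 - u"] u by simp
    show "norm u \<ge> 0.738" using norm_triangle_ineq2[of 1 "1 - u"] u by simp
  qed
  have slit: "u \<in> slit_plane" "u \<notin> \<real>\<^sub>\<le>\<^sub>0" if "u \<in> closed_segment c r" for u
    using near(3)[OF that] by (auto simp: slit_plane_iff complex_nonpos_Reals_iff)
  have "norm (r - (c - phi 0 B c / phi_deriv 0 B c))
      \<le> 1 / (2 * 0.738) * (1 + norm c / (pi * 0.136)) * (norm (r - c))\<^sup>2"
    by (rule newton_step)
      (use B near slit r_zero in \<open>auto intro: phi_deriv_has_field_derivative\<close>)
  also have "\<dots> \<le> 2.27 * (0.024 * b\<^sup>2)"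
  proof (rule mult_mono)
    show "1 / (2 * 0.738) * (1 + norm c / (pi * 0.136)) \<le> 2.27"
      using pi_approx nc by (simp add: field_simps)
  qed (use e0_sq in auto)
  also have "\<dots> \<le> 0.055 * b"
    using b by (simp add: power2_eq_square)
  finally have e1: "norm (r - newton_seq 0 B 1) \<le> 0.055 * b"
    by (simp only: One_nat_def newton_seq.simps(2) c_eq)
  \<comment> \<open>The constants leave room for the radius \<open>0.055 * b\<close>:
    \<open>0.08 <= 0.136 - 0.055\<close> and \<open>0.68 <= 1 - 0.2618 - 0.055\<close>.\<close>
  show ?thesis
  proof (rule newton_tail[where r = r and m = "68 / 100" and h = "8 / 100" and \<epsilon> = "55 / 1000 * b"
        and M = "106 / 100" and K = "4"])
    have "norm (r - c) \<le> norm (r - 1) + norm (c - 1)"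
      using norm_triangle_ineq4[of "r - 1" "c - 1"] by simp
    then show "norm (r - newton_seq 0 B 0) < 1.18" unfolding c_eq using r_near c_near by simp
    have "norm r \<le> 1" unfolding r_def by (rule w_facts(5))
    then show "norm r + 55 / 1000 * b \<le> 106 / 100" using b by simp
    show "1 / (2 * (68 / 100)) * (1 + 106 / 100 / (pi * (8 / 100))) \<le> 4"
      using pi_approx by (simp add: field_simps)
    fix u assume u: "norm (u - r) \<le> 55 / 1000 * b"
    have i: "Im u \<ge> 8 / 100 * b" using abs_Im_le_cmod[of "u - r"] u Im_r b by simp
    then show "Im u \<noteq> 0" using b by auto
    show "norm (1 - u) \<ge> 8 / 100 / of_int B"
      unfolding bB using abs_Im_le_cmod[of "1 - u"] i by simp
    have "norm (u - 1) \<le> 32 / 100"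
      using norm_triangle_ineq[of "u - r" "r - 1"] u r_near b by simp
    then show "norm u \<ge> 68 / 100" using norm_triangle_ineq2[of 1 "1 - u"] by (simp add: norm_minus_commute)
  qed (use B r_zero b e1 in auto)
qed

theorem theorem6p5:
  fixes A B :: int
  assumes "- (real_of_int B / 2) < real_of_int A"
    and "real_of_int A \<le> real_of_int B / 2"
  shows "newton_seq A B \<longlonglongrightarrow> phi_zero A B \<and>
    (\<forall>n. norm (phi_zero A B - newton_seq A B n) < 1.25 * 0.95 ^ (2 ^ n))"
proof -
  have "- B < 2 * A" "2 * A \<le> B" using assms by linarith+
  \<comment> \<open>The strict lower bound excludes \<open>2 * A = - B\<close>, so the only boundary
    case is the upper one, in which \<open>B\<close> is even and positive.\<close>
  then consider "A = 0" "B \<ge> 1" | "A \<noteq> 0" "2 * \<bar>A\<bar> < B" | "2 * A = B" "B \<ge> 2"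
    by linarith
  then show ?thesis
  proof cases
    case 1
    then show ?thesis using newton_case_zero[of B] by simp
  next
    case 2
    then show ?thesis by (rule newton_case_interior)
  next
    case 3
    then show ?thesis by (rule newton_case_half)
  qed
qed

end
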